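(* Let $r>0$, $0<\epsilon \leq \frac{1}{4 \sqrt{2}}$ and $M > 0$. Let $T = d = \left\lfloor \frac{1}{32} \frac{\zeta_r}{\epsilon^2} \right\rfloor$, where $\zeta_r = \frac{r}{\tanh(r)}$. There is a globally g-convex and $M$-Lipschitz function $f \colon \mathbb{H}^d \to \mathbb{R}$, attaining its minimum $f^*$ in $B(x_{\mathrm{ref}}, r)$, such that the following holds: there is an oracle for $f$ such that running subgradient descent with Polyak step size with that oracle produces iterates $x_0, x_1, \ldots$ satisfying $f(x_k) - f^* \geq \epsilon M r$ for all $k = 0, \ldots, T-1$.
   Context: $\mathbb{H}^d$ ($d\ge2$) is $d$-dimensional hyperbolic space of constant sectional curvature $-1$, with a fixed reference point $x_{\mathrm{ref}}$; $B(x,r)=\{y:\mathrm{dist}(x,y)\le r\}$; $\log_x$ is the inverse of the exponential map $\exp_x$. A function $f$ is g-convex if $f(\gamma(t)) \le (1-t)f(x)+tf(y)$ for every geodesic $\gamma:[0,1]\to\mathbb{H}^d$ from $x$ to $y$ and $t\in[0,1]$; it is $M$-Lipschitz if $|f(x)-f(y)|\le M\,\mathrm{dist}(x,y)$ for all $x,y$. A subgradient of $f$ at $x$ is $g\in\mathrm{T}_x\mathbb{H}^d$ with $f(y)\ge f(x)+\langle g,\log_x(y)\rangle$ for all $y$; $\partial f(x)$ is the set of subgradients. An oracle for $f$ returns, for each query $x$, the value $f(x)$ and a subgradient $g\in\partial f(x)$. Subgradient descent with Polyak step size (for a g-convex function $f$ with a minimizer in $B(x_{\mathrm{ref}},r)$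 and minimum value $f^*$): set $x_0=x_{\mathrm{ref}}$, $s_0=r$. At iteration $k\ge0$, query $x_k$ to receive $f(x_k)$ and $g_k\in\partial f(x_k)$, and set $x_{k+1}=\exp_{x_k}(-\eta_kg_k)$, where $\theta_k\in(0,\frac{\pi}{2})$, $\eta_k>0$ and $s_{k+1}$ are determined by $$\cos(\theta_k)=\frac{f(x_k)-f^*}{s_k\|g_k\|}=\frac{\tanh(\eta_k\|g_k\|)}{\tanh(s_k)},\qquad \sin(\theta_k)=\frac{\sinh(s_{k+1})}{\sinh(s_k)}.$$ (Geometrically, $x_{k+1}$ and $s_{k+1}$ are the center and radius of the minimal ball containing $B(x_k,s_k)\cap\{x:\langle g_k,\log_{x_k}(x)\rangle\le f^*-f(x_k)\}$.) *)

theory Defs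
  imports "HOL-Analysis.Analysis"
begin

text \<open>
  Hyperbolic space of dimension \<open>DIM('a)\<close> and curvature \<open>-1\<close> in the hyperboloid model: the
  upper sheet of \<open>\<langle>x, x\<rangle> = -1\<close> in \<open>real \<times> 'a\<close>, where \<open>lorentz\<close> is the Minkowski form whose
  time-like coordinate is the first one. The Riemannian metric is the restriction of
  \<open>lorentz\<close> to the tangent spaces. Points and tangent vectors both live in \<open>real \<times> 'a\<close>, so
  everything is relativised to the carriers \<open>hyp_space\<close> and \<open>hyp_tangent x\<close>. The instances
  \<open>dist\<close>, \<open>norm\<close> and \<open>\<bullet>\<close> of \<open>real \<times> 'a\<close> are the Euclidean ones of the ambient space and are not
  the hyperbolic ones.
\<close>

definition lorentz :: "real \<times> 'a::euclidean_space \<Rightarrow> real \<times> 'a \<Rightarrow> real" where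
  "lorentz u v = snd u \<bullet> snd v - fst u * fst v"

definition hyp_space :: "(real \<times> 'a::euclidean_space) set" where
  "hyp_space = {x. lorentz x x = -1 \<and> fst x > 0}"

definition hyp_tangent :: "real \<times> 'a::euclidean_space \<Rightarrow> (real \<times> 'a) set" where
  "hyp_tangent x = {v. lorentz x v = 0}"

definition hyp_norm :: "real \<times> 'a::euclidean_space \<Rightarrow> real" where
  "hyp_norm v = sqrt (lorentz v v)"

definition hyp_dist :: "real \<times> 'a::euclidean_space \<Rightarrow> real \<times> 'a \<Rightarrow> real" where
  "hyp_dist x y = arcosh (- lorentz x y)"

definition hyp_cball :: "real \<times> 'a::euclidean_space \<Rightarrow> real \<Rightarrow> (real \<times> 'a) set" where
  "hyp_cball x r = {y \<in> hyp_space. hyp_dist x y \<le> r}"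

text \<open>At \<open>v = 0\<close> the convention \<open>0 / 0 = 0\<close> gives the intended value \<open>hyp_exp x 0 = x\<close>.\<close>

definition hyp_exp :: "real \<times> 'a::euclidean_space \<Rightarrow> real \<times> 'a \<Rightarrow> real \<times> 'a" where
  "hyp_exp x v = cosh (hyp_norm v) *\<^sub>R x + (sinh (hyp_norm v) / hyp_norm v) *\<^sub>R v"

text \<open>\<open>hyp_exp x\<close> is a bijection from \<open>hyp_tangent x\<close> onto \<open>hyp_space\<close>; see \<open>bij_betw_hyp_exp\<close> below.\<close>

definition hyp_log :: "real \<times> 'a::euclidean_space \<Rightarrow> real \<times> 'a \<Rightarrow> real \<times> 'a" where
  "hyp_log x = inv_into (hyp_tangent x) (hyp_exp x)"

text \<open>Geodesics are parametrised on \<open>[0, 1]\<close> with constant speed, as in \<open>exp\<^sub>x (t v)\<close>.\<close>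

definition hyp_geodesic :: "(real \<Rightarrow> real \<times> 'a::euclidean_space) \<Rightarrow> bool" where
  "hyp_geodesic \<gamma> \<longleftrightarrow>
    (\<exists>x \<in> hyp_space. \<exists>v \<in> hyp_tangent x. \<forall>t \<in> {0..1}. \<gamma> t = hyp_exp x (t *\<^sub>R v))"

definition g_convex :: "(real \<times> 'a::euclidean_space \<Rightarrow> real) \<Rightarrow> bool" where
  "g_convex f \<longleftrightarrow>
    (\<forall>\<gamma>. hyp_geodesic \<gamma> \<longrightarrow> (\<forall>t \<in> {0..1}. f (\<gamma> t) \<le> (1 - t) * f (\<gamma> 0) + t * f (\<gamma> 1)))"

definition hyp_lipschitz :: "real \<Rightarrow> (real \<times> 'a::euclidean_space \<Rightarrow> real) \<Rightarrow> bool" where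
  "hyp_lipschitz M f \<longleftrightarrow>
    (\<forall>x \<in> hyp_space. \<forall>y \<in> hyp_space. \<bar>f x - f y\<bar> \<le> M * hyp_dist x y)"

definition hyp_subdifferential ::
  "(real \<times> 'a::euclidean_space \<Rightarrow> real) \<Rightarrow> real \<times> 'a \<Rightarrow> (real \<times> 'a) set" where
  "hyp_subdifferential f x =
    {g \<in> hyp_tangent x. \<forall>y \<in> hyp_space. f y \<ge> f x + lorentz g (hyp_log x y)}"

text \<open>
  An oracle is a function of the query point alone. It answers a query with the value and a
  subgradient.
\<close>

type_synonym 'a first_order_oracle = "real \<times> 'a \<Rightarrow> real \<times> (real \<times> 'a)"

definition is_oracle ::
  "(real \<times> 'a::euclidean_space \<Rightarrow> real) \<Rightarrow> 'a first_order_oracle \<Rightarrow> bool" where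
  "is_oracle f orc \<longleftrightarrow>
    (\<forall>x \<in> hyp_space. fst (orc x) = f x \<and> snd (orc x) \<in> hyp_subdifferential f x)"

definition polyak_step ::
  "real \<Rightarrow> 'a::euclidean_space first_order_oracle \<Rightarrow> real \<times> 'a \<Rightarrow> real \<Rightarrow> real \<times> 'a \<Rightarrow> real \<Rightarrow> bool" where
  "polyak_step fstar orc x s x' s' \<longleftrightarrow>
    (\<exists>fx g \<theta> \<eta>.
      orc x = (fx, g) \<and> 0 < \<theta> \<and> \<theta> < pi / 2 \<and> 0 < \<eta> \<and>
      cos \<theta> = (fx - fstar) / (s * hyp_norm g) \<and>
      cos \<theta> = tanh (\<eta> * hyp_norm g) / tanh s \<and>
      sin \<theta> = sinh s' / sinh s \<and>
      x' = hyp_exp x (- \<eta> *\<^sub>R g))"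

text \<open>
  The iterations \<open>0, \<dots>, N - 1\<close> of subgradient descent with Polyak step size. The number of
  iterations is a parameter because the step is not defined at a minimizer. By
  \<open>polyak_run_unique\<close> below, the oracle determines the iterates.
\<close>

definition polyak_run ::
  "real \<Rightarrow> 'a::euclidean_space first_order_oracle \<Rightarrow> real \<times> 'a \<Rightarrow> real \<Rightarrow> nat \<Rightarrow>
    (nat \<Rightarrow> real \<times> 'a) \<Rightarrow> (nat \<Rightarrow> real) \<Rightarrow> bool" where
  "polyak_run fstar orc xref r N x s \<longleftrightarrow>
    x 0 = xref \<and> s 0 = r \<and> (\<forall>k<N. polyak_step fstar orc (x k) (s k) (x (Suc k)) (s (Suc k)))"

definition curv_zeta :: "real \<Rightarrow> real" where
  "curv_zeta r = r / tanh r"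

lemma lorentz_algebra:
  "lorentz u v = lorentz v u"
  "lorentz (u + w) v = lorentz u v + lorentz w v"
  "lorentz v (u + w) = lorentz v u + lorentz v w"
  "lorentz (u - w) v = lorentz u v - lorentz w v"
  "lorentz v (u - w) = lorentz v u - lorentz v w"
  "lorentz (c *\<^sub>R u) v = c * lorentz u v"
  "lorentz v (c *\<^sub>R u) = c * lorentz v u"
  by (simp_all add: lorentz_def inner_commute inner_add_left inner_add_right
      inner_diff_left inner_diff_right algebra_simps)

lemma lorentz_tangent_pos:
  assumes "x \<in> hyp_space" "v \<in> hyp_tangent x" "v \<noteq> 0"
  shows "lorentz v v > 0"
proof -
  obtain a b p q where xv: "x = (a, b)" "v = (p, q)" by (metis surj_pair)
  have a: "a * a = 1 + b \<bullet> b" and a0: "a > 0" and pa: "a * p = b \<bullet> q"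
    using assms by (auto simp: xv lorentz_def hyp_space_def hyp_tangent_def)
  have "(b \<bullet> q)^2 \<le> (b \<bullet> b) * (q \<bullet> q)" by (rule Cauchy_Schwarz_ineq)
  moreover have "b \<bullet> b = a * a - 1" using a by simp
  ultimately have "(a * a) * (p * p) \<le> (a * a - 1) * (q \<bullet> q)"
    by (simp add: power2_eq_square ac_simps flip: pa)
  then have *: "q \<bullet> q \<le> (a * a) * (q \<bullet> q - p * p)" by (simp add: algebra_simps)
  show ?thesis
  proof (cases "q = 0")
    case True
    then show ?thesis using pa a0 assms(3) by (simp add: xv zero_prod_def)
  next
    case False
    then have "0 < (a * a) * (q \<bullet> q - p * p)" using * by (meson inner_gt_zero_iff less_le_trans)
    then show ?thesis using a0 by (simp add: zero_less_mult_iff xv lorentz_def)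
  qed
qed

lemma hyp_norm_tangent:
  assumes "x \<in> hyp_space" "v \<in> hyp_tangent x"
  shows "lorentz v v = (hyp_norm v)^2" "hyp_norm v \<ge> 0" "hyp_norm v = 0 \<longleftrightarrow> v = 0"
proof -
  have "lorentz v v \<ge> 0"
    using lorentz_tangent_pos[OF assms] by (cases "v = 0") (auto simp: lorentz_def)
  moreover have "lorentz v v = 0 \<longleftrightarrow> v = 0"
    using lorentz_tangent_pos[OF assms] by (cases "v = 0") (auto simp: lorentz_def)
  ultimately show "lorentz v v = (hyp_norm v)^2" "hyp_norm v \<ge> 0" "hyp_norm v = 0 \<longleftrightarrow> v = 0"
    by (auto simp: hyp_norm_def)
qed

lemma lorentz_hyp_space_ge:
  assumes "x \<in> hyp_space" "y \<in> hyp_space"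
  shows "- lorentz x y \<ge> 1"
proof -
  define v where "v = y + lorentz x y *\<^sub>R x"
  have xx: "lorentz x x = -1" and yy: "lorentz y y = -1" using assms by (auto simp: hyp_space_def)
  have "v \<in> hyp_tangent x" by (simp add: v_def hyp_tangent_def lorentz_algebra(2-7) xx)
  then have "lorentz v v \<ge> 0" using hyp_norm_tangent(1)[OF assms(1)] by simp
  then have sq: "(lorentz x y)^2 \<ge> 1"
    by (simp add: v_def lorentz_algebra(2-7) xx yy lorentz_algebra(1)[of y x] power2_eq_square)
  have "(norm (snd x))^2 < (fst x)^2" "(norm (snd y))^2 < (fst y)^2" "fst x > 0" "fst y > 0"
    using assms by (auto simp: hyp_space_def lorentz_def power2_eq_square dot_square_norm)
  then have "norm (snd x) < fst x" "norm (snd y) < fst y" by (auto intro: power_less_imp_less_base)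
  then have "norm (snd x) * norm (snd y) \<le> fst x * fst y"
    using \<open>fst x > 0\<close> by (intro mult_mono) auto
  then have "snd x \<bullet> snd y \<le> fst x * fst y" using norm_cauchy_schwarz order_trans by blast
  then have "lorentz x y \<le> 0" by (simp add: lorentz_def)
  then show ?thesis using sq
    by (metis abs_le_square_iff abs_of_nonpos abs_one one_power2)
qed

lemma lorentz_hyp_exp:
  assumes "x \<in> hyp_space" "v \<in> hyp_tangent x"
  shows "lorentz x (hyp_exp x v) = - cosh (hyp_norm v)"
  using assms by (simp add: hyp_exp_def hyp_space_def hyp_tangent_def lorentz_algebra(2-7))

lemma hyp_dist_hyp_exp:
  assumes "x \<in> hyp_space" "v \<in> hyp_tangent x"
  shows "hyp_dist x (hyp_exp x v) = hyp_norm v"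
  by (simp add: hyp_dist_def lorentz_hyp_exp[OF assms] hyp_norm_tangent[OF assms] arcosh_cosh_real)

lemma hyp_exp_in_hyp_space:
  assumes "x \<in> hyp_space" "v \<in> hyp_tangent x"
  shows "hyp_exp x v \<in> hyp_space"
proof -
  define n where "n = hyp_norm v"
  have xx: "lorentz x x = -1" and xv: "lorentz x v = 0" "lorentz v x = 0" "fst x > 0"
    using assms by (auto simp: hyp_space_def hyp_tangent_def lorentz_algebra(1)[of v])
  have vv: "lorentz v v = n^2" "n = 0 \<longleftrightarrow> v = 0" using hyp_norm_tangent[OF assms] by (auto simp: n_def)
  have "lorentz (hyp_exp x v) (hyp_exp x v) = (sinh n / n)^2 * n^2 - (cosh n)^2"
    by (simp add: hyp_exp_def n_def[symmetric] lorentz_algebra(2-7) xx xv vv power2_eq_square)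
  also have "\<dots> = (sinh n)^2 - (cosh n)^2" by (cases "n = 0") (auto simp: field_simps)
  finally have yy: "lorentz (hyp_exp x v) (hyp_exp x v) = -1" by (simp add: cosh_square_eq)
  have neg: "lorentz x (hyp_exp x v) < 0"
    using lorentz_hyp_exp[OF assms] by (simp add: cosh_real_pos)
  obtain a b p q where ab: "x = (a, b)" "hyp_exp x v = (p, q)" by (metis surj_pair)
  have "p > 0"
  proof (rule ccontr)
    assume "\<not> p > 0"
    then have p: "p \<le> 0" by simp
    have sq: "(norm b)^2 \<le> a^2" "(norm q)^2 \<le> (- p)^2" and a0: "a \<ge> 0"
      using xx yy xv(3) unfolding ab(2) unfolding ab(1)
      by (auto simp: lorentz_def power2_eq_square dot_square_norm)
    have "norm b \<le> a" using sq(1) a0 by (rule power2_le_imp_le)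
    moreover have "norm q \<le> - p" by (rule power2_le_imp_le[OF sq(2)]) (use p in simp)
    ultimately have "norm b * norm q \<le> a * (- p)" using a0 by (intro mult_mono) auto
    moreover have "- (b \<bullet> q) \<le> norm b * norm q"
      using norm_cauchy_schwarz[of b "- q"] by simp
    ultimately have "lorentz x (hyp_exp x v) \<ge> 0" unfolding ab(2) unfolding ab(1) by (simp add: lorentz_def)
    then show False using neg by simp
  qed
  then show ?thesis using yy ab by (simp add: hyp_space_def)
qed

lemma bij_betw_hyp_exp:
  assumes x: "x \<in> hyp_space"
  shows "bij_betw (hyp_exp x) (hyp_tangent x) hyp_space"
proof (rule bij_betw_imageI)
  show "inj_on (hyp_exp x) (hyp_tangent x)"
  proof (rule inj_onI)
    fix v w assume vw: "v \<in> hyp_tangent x" "w \<in> hyp_tangent x" and eq: "hyp_exp x v = hyp_exp x w"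
    have n: "hyp_norm v = hyp_norm w" using hyp_dist_hyp_exp[OF x] vw eq by metis
    show "v = w"
    proof (cases "hyp_norm v = 0")
      case True
      then show ?thesis using n hyp_norm_tangent(3)[OF x] vw by metis
    next
      case False
      then show ?thesis using eq n by (simp add: hyp_exp_def)
    qed
  qed
  show "hyp_exp x ` hyp_tangent x = hyp_space"
  proof (intro equalityI subsetI)
    fix y assume "y \<in> hyp_exp x ` hyp_tangent x"
    then show "y \<in> hyp_space" using hyp_exp_in_hyp_space[OF x] by auto
  next
    fix y :: "real \<times> 'a" assume y: "y \<in> hyp_space"
    define c where "c = - lorentz x y"
    define n where "n = arcosh c"
    define w where "w = y - c *\<^sub>R x"
    have c1: "c \<ge> 1" using lorentz_hyp_space_ge[OF x y] by (simp add: c_def)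
    have n0: "n \<ge> 0" and cn: "cosh n = c" using c1 by (auto simp: n_def)
    have xx: "lorentz x x = -1" and yy: "lorentz y y = -1" using x y by (auto simp: hyp_space_def)
    have wt: "w \<in> hyp_tangent x"
      by (simp add: w_def hyp_tangent_def lorentz_algebra(2-7) xx c_def)
    have "lorentz w w = c^2 - 1"
      by (simp add: w_def lorentz_algebra(2-7) xx yy lorentz_algebra(1)[of y x] c_def power2_eq_square)
    then have ww: "lorentz w w = (sinh n)^2" by (simp add: cosh_square_eq flip: cn)
    then have nw: "hyp_norm w = sinh n" using n0 by (simp add: hyp_norm_def)
    define v where "v = (n / sinh n) *\<^sub>R w"
    have vt: "v \<in> hyp_tangent x" using wt by (simp add: v_def hyp_tangent_def lorentz_algebra(7))
    have "hyp_exp x v = y"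
    proof (cases "n = 0")
      case True
      then have "w = 0" using hyp_norm_tangent(3)[OF x wt] nw by simp
      then have "y = x" using True cn by (simp add: w_def)
      then show ?thesis using True by (simp add: v_def hyp_exp_def hyp_norm_def lorentz_def)
    next
      case False
      then have s: "sinh n > 0" using n0 by simp
      have "lorentz v v = n^2" using s by (simp add: v_def lorentz_algebra(6,7) ww power2_eq_square)
      then have nv: "hyp_norm v = n" using n0 by (simp add: hyp_norm_def)
      have "hyp_exp x v = c *\<^sub>R x + w" using False s nv cn by (simp add: hyp_exp_def v_def)
      then show ?thesis by (simp add: w_def)
    qed
    then show "y \<in> hyp_exp x ` hyp_tangent x" using vt by blast
  qed
qed

lemma polyak_step_unique:
  assumes "polyak_step fstar orc x s y t" "polyak_step fstar orc x s y' t'"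
  shows "y = y' \<and> t = t'"
proof -
  obtain fx g \<theta> \<eta> where o: "orc x = (fx, g)" and 1: "0 < \<theta>" "\<theta> < pi / 2"
      "cos \<theta> = (fx - fstar) / (s * hyp_norm g)" "cos \<theta> = tanh (\<eta> * hyp_norm g) / tanh s"
      "sin \<theta> = sinh t / sinh s" "y = hyp_exp x (- \<eta> *\<^sub>R g)"
    using assms(1) unfolding polyak_step_def by (elim exE conjE) (rule that; assumption)
  obtain fx' g' \<theta>' \<eta>' where o': "orc x = (fx', g')" and 3: "0 < \<theta>'" "\<theta>' < pi / 2"
      "cos \<theta>' = (fx' - fstar) / (s * hyp_norm g')" "cos \<theta>' = tanh (\<eta>' * hyp_norm g') / tanh s"
      "sin \<theta>' = sinh t' / sinh s" "y' = hyp_exp x (- \<eta>' *\<^sub>R g')"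
    using assms(2) unfolding polyak_step_def by (elim exE conjE) (rule that; assumption)
  have "fx' = fx" "g' = g" using o o' by simp_all
  note 2 = 3[unfolded this]
  have th: "\<theta> = \<theta>'" by (rule cos_inj_pi) (use 1(1,2) 2(1,2) in linarith, use 1(1,2) 2(1,2) in linarith,
        use 1(1,2) 2(1,2) in linarith, use 1(1,2) 2(1,2) in linarith, simp only: 1(3) 2(3))
  have "cos \<theta> > 0" using 1(1,2) by (intro cos_gt_zero)
  then have nz: "hyp_norm g \<noteq> 0" "s \<noteq> 0" unfolding 1(3) by (auto simp del: divide_eq_0_iff)
  then have "tanh (\<eta> * hyp_norm g) = tanh (\<eta>' * hyp_norm g)" using 1(4) 2(4) th by simp
  then have "\<eta> = \<eta>'" using nz by simp
  moreover have "sinh t = sinh t'" using 1(5) 2(5) th nz by simp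
  ultimately show ?thesis using 1(6) 2(6) by simp
qed

lemma polyak_run_unique:
  assumes "polyak_run fstar orc xref r N x s" "polyak_run fstar orc xref r N y t" "k \<le> N"
  shows "x k = y k \<and> s k = t k"
  using assms(3)
proof (induction k)
  case 0
  then show ?case using assms(1,2) by (simp add: polyak_run_def)
next
  case (Suc k)
  then have eq: "x k = y k" "s k = t k" and "k < N" by auto
  then have "polyak_step fstar orc (x k) (s k) (x (Suc k)) (s (Suc k))"
      "polyak_step fstar orc (x k) (s k) (y (Suc k)) (t (Suc k))"
    using assms(1,2) by (auto simp: polyak_run_def)
  then show ?case by (rule polyak_step_unique)
qed

end

theory Submission
  imports Defs
begin

text \<open>
  Let \<open>z\<close> be a point at distance \<open>\<rho> < r\<close> from the reference point and let \<open>n 0, n 1, \<dots>\<close> be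
  orthonormal vectors orthogonal to both points. The hard function is
  \<open>f y = C (c dist z y + \<sigma> max\<^sub>k dist (y, H k))\<close> with \<open>c\<^sup>2 + \<sigma>\<^sup>2 = 1\<close>, where \<open>H k\<close> is the half-space
  bounded by the hyperplane through \<open>z\<close> with normal \<open>n k\<close>. Its minimizer is \<open>z\<close>. As long as
  \<open>x k\<close> lies on the boundary of \<open>H k\<close>, the oracle may answer with the unit vector (up to the
  factor \<open>C\<close>) that mixes the direction away from \<open>z\<close> and \<open>n k\<close> with weights \<open>c\<close> and \<open>\<sigma>\<close>. The
  line in this direction has distance \<open>arsinh (\<sigma> sinh (dist z (x k)))\<close> from \<open>z\<close>, so a step shrinks
  \<open>sinh (dist z (x k))\<close> at most by the factor \<open>\<sigma>\<close>, while it moves into the interior of \<open>H k\<close>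
  and stays on the boundary of the later half-spaces. With \<open>c\<^sup>2 = 8 \<epsilon>\<^sup>2\<close> the total shrinking in
  \<open>T\<close> steps is at most \<open>exp (\<zeta> / 6)\<close>, which leaves \<open>dist z (x k) \<ge> r / 2\<close> if
  \<open>sinh \<rho> = exp (\<zeta> / 6) sinh (r / 2)\<close>. The dimension leaves room for \<open>T - 1\<close> normals only;
  the strict inequality \<open>\<rho> < r\<close> makes the last step possible without one.
\<close>

section \<open>Inequalities for hyperbolic functions\<close>

lemma nondecreasing_if_deriv_nonneg:
  fixes f f' :: "real \<Rightarrow> real"
  assumes "\<And>t. (f has_real_derivative f' t) (at t)" "\<And>t. a \<le> t \<Longrightarrow> 0 \<le> f' t" "a \<le> b"
  shows "f a \<le> f b"
  by (rule DERIV_nonneg_imp_nondecreasing[OF assms(3)]) (use assms in blast)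

text \<open>Monotonicity of \<open>sinh t / t\<close>: the derivative of
  \<open>x * sinh t - t * sinh x\<close> in \<open>t\<close> is nonnegative from
  \<open>t = x\<close> on.\<close>

lemma sinh_mult_le:
  fixes x y :: real
  assumes "0 < x" "x \<le> y"
  shows "y * sinh x \<le> x * sinh y"
proof -
  have "x * cosh t - sinh x \<ge> 0" if "x \<le> t" for t
  proof -
    have D: "((\<lambda>t. t * cosh t - sinh t) has_real_derivative (t * sinh t)) (at t)" for t :: real
      by (auto intro!: derivative_eq_intros)
    have "0 * cosh 0 - sinh 0 \<le> x * cosh x - sinh x"
      by (rule nondecreasing_if_deriv_nonneg[OF D]) (use assms in auto)
    moreover have "x * cosh x \<le> x * cosh t"
      using assms that by (simp add: cosh_real_nonneg_le_iff)
    ultimately show ?thesis by simp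
  qed
  moreover have D: "((\<lambda>t. x * sinh t - t * sinh x) has_real_derivative (x * cosh t - sinh x)) (at t)" for t
    by (auto intro!: derivative_eq_intros)
  ultimately have "x * sinh x - x * sinh x \<le> x * sinh y - y * sinh x"
    using assms(2) by (intro nondecreasing_if_deriv_nonneg[OF D])
  then show ?thesis by simp
qed

lemma one_minus_tanh_square: "1 - (tanh x)^2 = 1 / (cosh x)^2" for x :: real
  by (simp add: tanh_def power_divide sinh_square_eq diff_divide_distrib)

text \<open>\<open>tanh t / t\<close> is nonincreasing. The slope of \<open>tanh\<close> decreases,
  so the derivative in \<open>t\<close> need only be checked at \<open>t = x\<close>, where it
  amounts to \<open>x \<le> sinh x * cosh x\<close>.\<close>

lemma tanh_mult_le:
  fixes x y :: real
  assumes "0 < x" "x \<le> y"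
  shows "x * tanh y \<le> y * tanh x"
proof -
  have D: "((\<lambda>t. t * tanh x - x * tanh t) has_real_derivative (tanh x - x * (1 - (tanh t)^2))) (at t)" for t
    by (auto intro!: derivative_eq_intros)
  have "tanh x - x * (1 - (tanh t)^2) \<ge> 0" if "x \<le> t" for t
  proof -
    have "x \<le> sinh x * cosh x"
    proof -
      have D: "((\<lambda>t. sinh t * cosh t - t) has_real_derivative (2 * (sinh t)^2)) (at t)" for t :: real
        by (auto intro!: derivative_eq_intros simp: cosh_square_eq power2_eq_square[symmetric])
      have "sinh 0 * cosh 0 - 0 \<le> sinh x * cosh x - x"
        by (rule nondecreasing_if_deriv_nonneg[OF D]) (use assms in auto)
      then show ?thesis by simp
    qed
    then have "x * (1 - (tanh x)^2) \<le> tanh x"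
      unfolding one_minus_tanh_square by (simp add: tanh_def field_simps power2_eq_square)
    moreover have "(tanh x)^2 \<le> (tanh t)^2"
      using assms that by (intro power_mono) auto
    then have "x * (1 - (tanh t)^2) \<le> x * (1 - (tanh x)^2)"
      using assms by (intro mult_left_mono) auto
    ultimately show ?thesis by simp
  qed
  then have "x * tanh x - x * tanh x \<le> y * tanh x - x * tanh y"
    using assms(2) by (rule nondecreasing_if_deriv_nonneg[OF D])
  then show ?thesis by simp
qed

lemma sinh_le_chord:
  fixes \<tau> b :: real
  assumes "0 \<le> \<tau>" "\<tau> \<le> b"
  shows "sinh \<tau> \<le> sinh b / b * \<tau>"
  using sinh_mult_le[of \<tau> b] assms by (cases "\<tau> = 0") (auto simp: field_simps)

text \<open>
  Law of cosines against the first-order expansion of the distance: \<open>a\<close>, \<open>b\<close> are two sides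
  and \<open>\<tau> = - b cos C\<close> for the enclosed angle \<open>C\<close>.
\<close>

lemma cosh_add_le_law_of_cosines:
  fixes a b \<tau> :: real
  assumes "0 \<le> a" "\<bar>\<tau>\<bar> \<le> b"
  shows "cosh (a + \<tau>) \<le> cosh a * cosh b + sinh a * (sinh b / b * \<tau>)"
proof (cases "b = 0")
  case False
  then have b: "b > 0" using assms by simp
  \<comment> \<open>By the addition theorem the claim is \<open>sinh a * Y \<le> cosh a * X\<close>.
    Since \<open>sinh a \<le> cosh a\<close> and \<open>X\<close> is nonnegative,
    \<open>Y \<le> X\<close> suffices; this compares \<open>exp\<close> with its chord on
    \<open>[-b, b]\<close>.\<close>
  define X where "X = cosh b - cosh \<tau>"
  define Y where "Y = sinh \<tau> - sinh b / b * \<tau>"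
  have X0: "X \<ge> 0" using assms by (simp add: X_def cosh_real_abs[symmetric, of \<tau>] cosh_real_nonneg_le_iff del: cosh_real_abs)
  define l where "l = (1 + \<tau> / b) / 2"
  have l: "0 \<le> l" "l \<le> 1" using assms b by (auto simp: l_def field_simps)
  have "exp ((1 - l) *\<^sub>R (-b) + l *\<^sub>R b) \<le> (1 - l) * exp (-b) + l * exp b"
    using convex_onD[OF exp_convex, of l "-b" b] l by simp
  moreover have "(1 - l) *\<^sub>R (-b) + l *\<^sub>R b = \<tau>" using b by (simp add: l_def field_simps)
  moreover have "(1 - l) * exp (-b) + l * exp b = cosh b + sinh b / b * \<tau>"
    using b by (simp add: l_def cosh_def sinh_def field_simps)
  moreover have "exp \<tau> = cosh \<tau> + sinh \<tau>" by (simp add: cosh_def sinh_def field_simps)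
  ultimately have XY: "Y \<le> X" by (simp add: X_def Y_def)
  have "sinh a * Y \<le> cosh a * X"
  proof (cases "Y \<ge> 0")
    case True
    then show ?thesis using XY assms
      by (intro mult_mono) (auto simp: sinh_le_cosh_real)
  next
    case False
    then have "sinh a * Y \<le> 0" using assms by (simp add: mult_nonneg_nonpos)
    also have "0 \<le> cosh a * X" using X0 by simp
    finally show ?thesis .
  qed
  then show ?thesis by (simp add: X_def Y_def cosh_add algebra_simps)
qed (use assms in simp)

text \<open>The counterpart of \<open>cosh_add_le_law_of_cosines\<close> for half-spaces:
  \<open>a\<close> is the distance from the hyperplane, \<open>b\<close> the length of the step and
  \<open>\<tau>\<close> the first-order change of the distance.\<close>

lemma sinh_add_le:
  fixes a b \<tau> :: real
  assumes "0 \<le> a + \<tau>" "0 \<le> a" "\<bar>\<tau>\<bar> \<le> b"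
  shows "sinh (a + \<tau>) \<le> sinh a * cosh b + cosh a * (sinh b / b * \<tau>)"
proof (cases "\<tau> \<ge> 0")
  case True
  have "cosh a * sinh \<tau> \<le> cosh a * (sinh b / b * \<tau>)"
    using sinh_le_chord[of \<tau> b] True assms by (intro mult_left_mono) auto
  moreover have "sinh a * cosh \<tau> \<le> sinh a * cosh b"
    using assms True by (intro mult_left_mono) (auto simp: cosh_real_nonneg_le_iff)
  ultimately show ?thesis by (simp add: sinh_add)
next
  case False
  \<comment> \<open>The claim reads \<open>cosh a * (sinh b / b * t - sinh t) \<le> sinh a * (cosh b
    - cosh t)\<close>. With \<open>t\<close> in place of \<open>a\<close> it follows from
    monotonicity of \<open>tanh t / t\<close>, and \<open>0 \<le> a + \<tau>\<close> gives
    \<open>t \<le> a\<close>.\<close>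
  define t where "t = - \<tau>"
  have t: "0 < t" "t \<le> b" "t \<le> a" using False assms by (auto simp: t_def)
  have "tanh b * t \<le> tanh t * b" using tanh_mult_le[OF t(1,2)] by (simp add: mult.commute)
  then have "sinh b / b * t * cosh t \<le> sinh t * cosh b"
    using t by (simp add: tanh_def field_simps)
  then have le: "cosh t * (sinh b / b * t - sinh t) \<le> sinh t * (cosh b - cosh t)"
    by (simp add: algebra_simps)
  have X0: "cosh b - cosh t \<ge> 0" using t by (simp add: cosh_real_nonneg_le_iff)
  have "tanh t \<le> tanh a" using t by simp
  then have "tanh t * (cosh b - cosh t) \<le> tanh a * (cosh b - cosh t)" using X0 by (rule mult_right_mono)
  moreover have "sinh b / b * t - sinh t \<le> tanh t * (cosh b - cosh t)"
    using le by (simp add: tanh_def field_simps)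
  ultimately have "sinh b / b * t - sinh t \<le> tanh a * (cosh b - cosh t)" by simp
  then have "cosh a * (sinh b / b * t - sinh t) \<le> cosh a * (tanh a * (cosh b - cosh t))"
    by (rule mult_left_mono) simp
  also have "\<dots> = sinh a * (cosh b - cosh t)" by (simp add: tanh_def)
  finally show ?thesis by (simp add: t_def sinh_add algebra_simps)
qed

section \<open>The Minkowski form on tangent spaces\<close>

lemma lorentz_zero [simp]: "lorentz 0 v = 0" "lorentz v 0 = 0"
  by (simp_all add: lorentz_def)

lemma lorentz_minus: "lorentz (- u) v = - lorentz u v" "lorentz v (- u) = - lorentz v u"
  by (simp_all add: lorentz_def)

lemmas lorentz_linear = lorentz_algebra(2-7) lorentz_minus

lemma hyp_tangent_linear:
  "0 \<in> hyp_tangent x"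
  "u \<in> hyp_tangent x \<Longrightarrow> v \<in> hyp_tangent x \<Longrightarrow> u + v \<in> hyp_tangent x"
  "v \<in> hyp_tangent x \<Longrightarrow> c *\<^sub>R v \<in> hyp_tangent x"
  "v \<in> hyp_tangent x \<Longrightarrow> - v \<in> hyp_tangent x"
  by (simp_all add: hyp_tangent_def lorentz_linear)

lemma hyp_norm_scaleR: "hyp_norm (c *\<^sub>R v) = \<bar>c\<bar> * hyp_norm v"
  by (simp add: hyp_norm_def lorentz_linear real_sqrt_mult flip: mult.assoc)

text \<open>The form is indefinite, but positive on tangent spaces, so the usual proof works: expand
  the square of \<open>n *\<^sub>R u + (- m) *\<^sub>R w\<close> for \<open>w = v\<close> and
  \<open>w = - v\<close>.\<close>

lemma lorentz_Cauchy_Schwarz: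
  assumes "x \<in> hyp_space" "u \<in> hyp_tangent x" "v \<in> hyp_tangent x"
  shows "\<bar>lorentz u v\<bar> \<le> hyp_norm u * hyp_norm v"
proof -
  define m n where "m = hyp_norm u" and "n = hyp_norm v"
  have uu: "lorentz u u = m^2" and vv: "lorentz v v = n^2" and mn: "0 \<le> m" "0 \<le> n"
    using hyp_norm_tangent[OF assms(1)] assms by (auto simp: m_def n_def)
  have *: "0 \<le> m * n * (m * n - lorentz u w)" if "w \<in> hyp_tangent x" "lorentz w w = n^2" for w
  proof -
    have "n *\<^sub>R u + (- m) *\<^sub>R w \<in> hyp_tangent x"
      using assms that by (intro hyp_tangent_linear)
    then have "0 \<le> lorentz (n *\<^sub>R u + (- m) *\<^sub>R w) (n *\<^sub>R u + (- m) *\<^sub>R w)"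
      using hyp_norm_tangent(1)[OF assms(1)] by simp
    also have "\<dots> = 2 * (m * n * (m * n - lorentz u w))"
      by (simp add: lorentz_linear uu that(2) lorentz_algebra(1)[of w u] algebra_simps power2_eq_square)
    finally show ?thesis by simp
  qed
  show ?thesis
  proof (cases "m * n = 0")
    case True
    then have "u = 0 \<or> v = 0" using hyp_norm_tangent(3)[OF assms(1)] assms by (auto simp: m_def n_def)
    then show ?thesis by (auto simp: hyp_norm_def)
  next
    case False
    then have "m * n > 0" using mn by (simp add: less_le)
    moreover have "0 \<le> m * n * (m * n - lorentz u v)" "0 \<le> m * n * (m * n - lorentz u (- v))"
      using *[OF assms(3)] *[OF hyp_tangent_linear(4)[OF assms(3)]] vv by (auto simp: lorentz_linear)
    ultimately have "lorentz u v \<le> m * n" "- lorentz u v \<le> m * n"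
      by (auto simp: zero_le_mult_iff lorentz_linear)
    then show ?thesis by (simp add: m_def n_def)
  qed
qed

lemma hyp_norm_triangle:
  assumes "x \<in> hyp_space" "u \<in> hyp_tangent x" "v \<in> hyp_tangent x"
  shows "hyp_norm (u + v) \<le> hyp_norm u + hyp_norm v"
proof (rule power2_le_imp_le)
  have "(hyp_norm (u + v))^2 = lorentz (u + v) (u + v)"
    using hyp_norm_tangent(1)[OF assms(1) hyp_tangent_linear(2)[OF assms(2,3)]] by simp
  also have "\<dots> = (hyp_norm u)^2 + (hyp_norm v)^2 + 2 * lorentz u v"
    using hyp_norm_tangent(1)[OF assms(1,2)] hyp_norm_tangent(1)[OF assms(1,3)]
    by (simp add: lorentz_linear lorentz_algebra(1)[of v u])
  also have "\<dots> \<le> (hyp_norm u + hyp_norm v)^2"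
    using lorentz_Cauchy_Schwarz[OF assms] by (simp add: power2_sum)
  finally show "(hyp_norm (u + v))^2 \<le> (hyp_norm u + hyp_norm v)^2" .
qed (use hyp_norm_tangent(2)[OF assms(1)] assms in auto)

lemma cosh_hyp_dist:
  assumes "x \<in> hyp_space" "y \<in> hyp_space"
  shows "cosh (hyp_dist x y) = - lorentz x y" "hyp_dist x y \<ge> 0"
  using lorentz_hyp_space_ge[OF assms] by (auto simp: hyp_dist_def)

lemma hyp_exp_scaleR:
  "hyp_exp x (r *\<^sub>R v) = cosh (r * hyp_norm v) *\<^sub>R x + (sinh (r * hyp_norm v) / hyp_norm v) *\<^sub>R v"
  by (cases "r \<ge> 0") (simp_all add: hyp_exp_def hyp_norm_scaleR)

lemma lorentz_hyp_exp_right: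
  "lorentz z (hyp_exp x v) = cosh (hyp_norm v) * lorentz z x + sinh (hyp_norm v) / hyp_norm v * lorentz z v"
  by (simp add: hyp_exp_def lorentz_linear)

section \<open>Geodesics and the calculus of subgradients\<close>

lemma hyp_log_hyp_exp:
  assumes "x \<in> hyp_space" "v \<in> hyp_tangent x"
  shows "hyp_log x (hyp_exp x v) = v"
  using bij_betw_hyp_exp[OF assms(1)] assms(2) by (simp add: hyp_log_def bij_betw_def)

text \<open>Writing the second point as \<open>hyp_exp x v\<close> removes the logarithm.\<close>

lemma mem_hyp_subdifferential_iff:
  assumes "x \<in> hyp_space"
  shows "g \<in> hyp_subdifferential f x \<longleftrightarrow>
    g \<in> hyp_tangent x \<and> (\<forall>v \<in> hyp_tangent x. f x + lorentz g v \<le> f (hyp_exp x v))"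
proof -
  have e: "hyp_exp x ` hyp_tangent x = hyp_space"
    using bij_betw_hyp_exp[OF assms] by (simp add: bij_betw_def)
  show ?thesis
    unfolding hyp_subdifferential_def e[symmetric] mem_Collect_eq ball_simps
    by (simp add: hyp_log_hyp_exp[OF assms] cong: ball_cong)
qed

text \<open>A geodesic can be restarted at any of its points with its velocity \<open>w\<close>
  there.\<close>

lemma hyp_exp_velocity:
  fixes x v :: "real \<times> 'a::euclidean_space"
  assumes x: "x \<in> hyp_space" and v: "v \<in> hyp_tangent x"
  obtains w where "w \<in> hyp_tangent (hyp_exp x (t *\<^sub>R v))"
    "\<And>r. hyp_exp (hyp_exp x (t *\<^sub>R v)) (r *\<^sub>R w) = hyp_exp x ((t + r) *\<^sub>R v)"
proof (cases "v = 0")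
  case True
  then show ?thesis
    by (intro that[of 0]) (simp_all add: hyp_exp_def hyp_norm_def hyp_tangent_def)
next
  case False
  define n where "n = hyp_norm v"
  have n: "n > 0" using hyp_norm_tangent[OF x v] False by (simp add: n_def less_le)
  define p where "p = cosh (t * n) *\<^sub>R x + (sinh (t * n) / n) *\<^sub>R v"
  \<comment> \<open>The derivative of \<open>p\<close> with respect to \<open>t\<close>.\<close>
  define w where "w = (n * sinh (t * n)) *\<^sub>R x + cosh (t * n) *\<^sub>R v"
  have l: "lorentz x x = - 1" "lorentz x v = 0" "lorentz v x = 0" "lorentz v v = n^2"
    using x v hyp_norm_tangent(1)[OF x v]
    by (auto simp: hyp_space_def hyp_tangent_def n_def lorentz_algebra(1)[of v x])
  have p: "hyp_exp x (t *\<^sub>R v) = p" by (simp add: hyp_exp_scaleR p_def n_def)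
  have "lorentz p w = 0"
    using n by (simp add: p_def w_def lorentz_linear l power2_eq_square)
  moreover have "lorentz w w = n^2 * ((cosh (t * n))^2 - (sinh (t * n))^2)"
    by (simp add: w_def lorentz_linear l power2_eq_square algebra_simps)
  then have "lorentz w w = n^2" by (simp add: cosh_square_eq)
  then have nw: "hyp_norm w = n" using n by (simp add: hyp_norm_def)
  have "hyp_exp p (r *\<^sub>R w) = hyp_exp x ((t + r) *\<^sub>R v)" for r
    using n unfolding hyp_exp_scaleR nw n_def[symmetric]
    by (simp add: p_def w_def distrib_right cosh_add sinh_add scaleR_add_right scaleR_add_left add_divide_distrib algebra_simps)
  ultimately show ?thesis using that[of w] by (simp add: p hyp_tangent_def)
qed

text \<open>A subgradient at \<open>\<gamma> t\<close> bounds \<open>f\<close> at both endpoints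
  from below by a function that is affine along the geodesic; the slope cancels in the weighted
  sum.\<close>

lemma g_convex_if_subgradients:
  fixes f :: "real \<times> 'a::euclidean_space \<Rightarrow> real"
  assumes "\<And>x. x \<in> hyp_space \<Longrightarrow> hyp_subdifferential f x \<noteq> {}"
  shows "g_convex f"
  unfolding g_convex_def
proof (intro allI impI ballI)
  fix \<gamma> :: "real \<Rightarrow> real \<times> 'a" and t :: real
  assume "hyp_geodesic \<gamma>" and t: "t \<in> {0..1}"
  then obtain x v where x: "x \<in> hyp_space" and v: "v \<in> hyp_tangent x"
    and \<gamma>: "\<And>t. t \<in> {0..1} \<Longrightarrow> \<gamma> t = hyp_exp x (t *\<^sub>R v)" by (auto simp: hyp_geodesic_def)
  obtain w where w: "w \<in> hyp_tangent (\<gamma> t)" "\<And>r. hyp_exp (\<gamma> t) (r *\<^sub>R w) = hyp_exp x ((t + r) *\<^sub>R v)"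
    using hyp_exp_velocity[OF x v] \<gamma>[OF t] by metis
  have p: "\<gamma> t \<in> hyp_space" using \<gamma>[OF t] hyp_exp_in_hyp_space[OF x] hyp_tangent_linear(3)[OF v] by simp
  obtain g where "g \<in> hyp_subdifferential f (\<gamma> t)" using assms[OF p] by blast
  then have g: "f (\<gamma> t) + r * lorentz g w \<le> f (hyp_exp x ((t + r) *\<^sub>R v))" for r
    using hyp_tangent_linear(3)[OF w(1), of r] w(2)[of r]
    by (auto simp: mem_hyp_subdifferential_iff[OF p] lorentz_linear dest!: bspec)
  have "f (\<gamma> t) - t * lorentz g w \<le> f (\<gamma> 0)" "f (\<gamma> t) + (1 - t) * lorentz g w \<le> f (\<gamma> 1)"
    using g[of "- t"] g[of "1 - t"] by (simp_all add: \<gamma>)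
  then have "(1 - t) * (f (\<gamma> t) - t * lorentz g w) + t * (f (\<gamma> t) + (1 - t) * lorentz g w)
      \<le> (1 - t) * f (\<gamma> 0) + t * f (\<gamma> 1)"
    using t by (intro add_mono mult_left_mono) auto
  then show "f (\<gamma> t) \<le> (1 - t) * f (\<gamma> 0) + t * f (\<gamma> 1)" by (simp add: algebra_simps)
qed

lemma hyp_lipschitz_if_subgradients:
  fixes f :: "real \<times> 'a::euclidean_space \<Rightarrow> real"
  assumes "\<And>x. x \<in> hyp_space \<Longrightarrow> \<exists>g \<in> hyp_subdifferential f x. hyp_norm g \<le> M"
  shows "hyp_lipschitz M f"
proof -
  have le: "f x - f y \<le> M * hyp_dist x y" if x: "x \<in> hyp_space" and y: "y \<in> hyp_space" for x y
  proof -
    obtain g where g: "g \<in> hyp_subdifferential f x" and n: "hyp_norm g \<le> M" using assms[OF x] by blast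
    obtain v where v: "v \<in> hyp_tangent x" and yv: "y = hyp_exp x v"
      using bij_betw_imp_surj_on[OF bij_betw_hyp_exp[OF x]] y by blast
    have gt: "g \<in> hyp_tangent x" and "f x + lorentz g v \<le> f y"
      using g v by (auto simp: mem_hyp_subdifferential_iff[OF x] yv)
    then have "f x - f y \<le> - lorentz g v" by simp
    also have "\<dots> \<le> hyp_norm g * hyp_norm v" using lorentz_Cauchy_Schwarz[OF x gt v] by simp
    also have "\<dots> \<le> M * hyp_norm v" using n hyp_norm_tangent(2)[OF x v] by (rule mult_right_mono)
    finally show ?thesis by (simp add: yv hyp_dist_hyp_exp[OF x v])
  qed
  have "hyp_dist x y = hyp_dist y x" for x y :: "real \<times> 'a"
    by (simp add: hyp_dist_def lorentz_algebra(1)[of x y])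
  then show ?thesis using le by (simp add: hyp_lipschitz_def abs_le_iff) metis
qed

lemma zero_mem_hyp_subdifferential:
  assumes "\<And>y. y \<in> hyp_space \<Longrightarrow> f x \<le> f y"
  shows "0 \<in> hyp_subdifferential f x"
  using assms by (auto simp: hyp_subdifferential_def hyp_tangent_linear)

text \<open>Meant for maxima: a subgradient of a term attaining the maximum at \<open>x\<close> is a
  subgradient of the maximum.\<close>

lemma hyp_subdifferential_mono:
  assumes "g \<in> hyp_subdifferential f x" "f x = h x" "\<And>y. y \<in> hyp_space \<Longrightarrow> f y \<le> h y"
  shows "g \<in> hyp_subdifferential h x"
  using assms by (force simp: hyp_subdifferential_def)

lemma hyp_subdifferential_combination:
  assumes "g \<in> hyp_subdifferential f x" "h \<in> hyp_subdifferential k x" "0 \<le> a" "0 \<le> b"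
  shows "a *\<^sub>R g + b *\<^sub>R h \<in> hyp_subdifferential (\<lambda>y. a * f y + b * k y) x"
proof -
  have "a * f x + b * k x + lorentz (a *\<^sub>R g + b *\<^sub>R h) (hyp_log x y) \<le> a * f y + b * k y"
    if "y \<in> hyp_space" for y
  proof -
    have "a * (f x + lorentz g (hyp_log x y)) + b * (k x + lorentz h (hyp_log x y)) \<le> a * f y + b * k y"
      using assms that by (intro add_mono mult_left_mono) (auto simp: hyp_subdifferential_def)
    then show ?thesis by (simp add: lorentz_linear algebra_simps)
  qed
  then show ?thesis using assms by (auto simp: hyp_subdifferential_def hyp_tangent_linear)
qed

section \<open>Subgradients of the distances to points and half-spaces\<close>

text \<open>At \<open>x = z\<close> the division by zero gives the subgradient \<open>0\<close>.\<close>

definition dist_subgradient :: "real \<times> 'a::euclidean_space \<Rightarrow> real \<times> 'a \<Rightarrow> real \<times> 'a" where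
  "dist_subgradient z x = (1 / sinh (hyp_dist z x)) *\<^sub>R (cosh (hyp_dist z x) *\<^sub>R x - z)"

text \<open>On \<open>hyp_space\<close>, \<open>cosh (hyp_dist z y)\<close> is linear in the ambient
  coordinates of \<open>y\<close>, so applying \<open>cosh\<close> reduces the subgradient
  inequality to \<open>cosh_add_le_law_of_cosines\<close>. The last claim serves to compute the
  distance from \<open>z\<close> after a step.\<close>

lemma dist_subgradient:
  assumes z: "z \<in> hyp_space" and x: "x \<in> hyp_space"
  shows "dist_subgradient z x \<in> hyp_subdifferential (hyp_dist z) x"
    and "hyp_norm (dist_subgradient z x) \<le> 1"
    and "hyp_dist z x \<noteq> 0 \<Longrightarrow> hyp_norm (dist_subgradient z x) = 1"
    and "lorentz z (dist_subgradient z x) = - sinh (hyp_dist z x)"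
proof -
  let ?g = "dist_subgradient z x"
  define a where "a = hyp_dist z x"
  have a: "cosh a = - lorentz z x" "0 \<le> a" using cosh_hyp_dist[OF z x] by (auto simp: a_def)
  have l: "lorentz x x = -1" "lorentz z z = -1" "lorentz z x = - cosh a" "lorentz x z = - cosh a"
    using x z a lorentz_algebra(1)[of x z] by (auto simp: hyp_space_def)
  have sinh2: "cosh a * cosh a = 1 + sinh a * sinh a"
    using cosh_square_eq[of a] by (simp add: power2_eq_square)
  have gt: "?g \<in> hyp_tangent x"
    by (simp add: dist_subgradient_def hyp_tangent_def a_def[symmetric] lorentz_linear l)
  have gg: "lorentz ?g ?g = (if a = 0 then 0 else 1)"
    by (cases "a = 0") (simp_all add: dist_subgradient_def a_def[symmetric] lorentz_linear l sinh2)
  then show n: "hyp_norm ?g \<le> 1" by (simp add: hyp_norm_def)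
  show "hyp_norm ?g = 1" if "hyp_dist z x \<noteq> 0" using gg that by (simp add: hyp_norm_def a_def)
  show "lorentz z ?g = - sinh (hyp_dist z x)"
    by (cases "a = 0") (simp_all add: dist_subgradient_def a_def[symmetric] lorentz_linear l sinh2)
  have "a + lorentz ?g v \<le> hyp_dist z (hyp_exp x v)" if v: "v \<in> hyp_tangent x" for v
  proof (cases "a + lorentz ?g v \<ge> 0")
    case True
    define b where "b = hyp_norm v"
    have b0: "b \<ge> 0" using hyp_norm_tangent[OF x v] by (simp add: b_def)
    have "\<bar>lorentz ?g v\<bar> \<le> hyp_norm ?g * b" using lorentz_Cauchy_Schwarz[OF x gt v] by (simp add: b_def)
    also have "\<dots> \<le> b" using mult_right_mono[OF n b0] by simp
    finally have "cosh (a + lorentz ?g v) \<le> cosh a * cosh b + sinh a * (sinh b / b * lorentz ?g v)"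
      by (rule cosh_add_le_law_of_cosines[OF a(2)])
    also have "\<dots> = cosh a * cosh b + sinh b / b * (sinh a * lorentz ?g v)" by (simp only: ac_simps)
    also have "sinh a * lorentz ?g v = - lorentz z v"
    \<comment> \<open>At distance zero the left side is \<open>0\<close>. There \<open>z - x\<close>
      is a tangent vector of norm zero, so \<open>z = x\<close> and the right side vanishes
      too.\<close>
    proof (cases "a = 0")
      case True
      have "z - x \<in> hyp_tangent x" "lorentz (z - x) (z - x) = 0"
        using True by (auto simp: hyp_tangent_def lorentz_linear l)
      then have "z = x" using lorentz_tangent_pos[OF x, of "z - x"] by fastforce
      then show ?thesis using v True by (simp add: hyp_tangent_def)
    next
      case False
      then show ?thesis using v
        by (simp add: dist_subgradient_def a_def[symmetric] lorentz_linear hyp_tangent_def)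
    qed
    also have "cosh a * cosh b + sinh b / b * - lorentz z v = - lorentz z (hyp_exp x v)"
      by (simp add: lorentz_hyp_exp_right b_def[symmetric] l)
    also have "\<dots> = cosh (hyp_dist z (hyp_exp x v))"
      using cosh_hyp_dist[OF z hyp_exp_in_hyp_space[OF x v]] by simp
    finally show ?thesis
      using True cosh_hyp_dist(2)[OF z hyp_exp_in_hyp_space[OF x v]] by (simp add: cosh_real_nonneg_le_iff)
  qed (use cosh_hyp_dist(2)[OF z hyp_exp_in_hyp_space[OF x v]] in simp)
  then show "?g \<in> hyp_subdifferential (hyp_dist z) x"
    by (simp add: mem_hyp_subdifferential_iff[OF x] gt a_def)
qed

text \<open>The distance to the half-space \<open>{y. lorentz n y \<le> 0}\<close>, where \<open>lorentz n n = 1\<close>.\<close>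

definition halfspace_dist :: "real \<times> 'a::euclidean_space \<Rightarrow> real \<times> 'a \<Rightarrow> real" where
  "halfspace_dist n y = max 0 (arsinh (lorentz n y))"

definition halfspace_subgradient :: "real \<times> 'a::euclidean_space \<Rightarrow> real \<times> 'a \<Rightarrow> real \<times> 'a" where
  "halfspace_subgradient n x = (1 / sqrt (1 + (lorentz n x)^2)) *\<^sub>R (n + lorentz n x *\<^sub>R x)"

text \<open>The vector is the normalised tangential part of \<open>n\<close>, and
  \<open>lorentz n y\<close> is \<open>sinh\<close> of the signed distance from the hyperplane. The
  boundary case matters: the function is \<open>0\<close> there and still has a unit
  subgradient.\<close>

lemma halfspace_subgradient:
  assumes x: "x \<in> hyp_space" and n: "lorentz n n = 1" and q0: "lorentz n x \<ge> 0"
  shows "halfspace_subgradient n x \<in> hyp_subdifferential (halfspace_dist n) x"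
    and "hyp_norm (halfspace_subgradient n x) = 1"
proof -
  let ?g = "halfspace_subgradient n x"
  define a where "a = arsinh (lorentz n x)"
  have q: "lorentz n x = sinh a" "lorentz x n = sinh a" and a0: "a \<ge> 0"
    using q0 lorentz_algebra(1)[of x n] sinh_real_nonneg_iff[of a] by (auto simp: a_def)
  have ca: "sqrt (1 + (lorentz n x)^2) = cosh a"
    by (intro real_sqrt_unique) (auto simp: q cosh_square_eq)
  have g: "?g = (1 / cosh a) *\<^sub>R (n + sinh a *\<^sub>R x)"
    unfolding halfspace_subgradient_def ca by (simp add: q)
  have xx: "lorentz x x = -1" using x by (simp add: hyp_space_def)
  have gt: "?g \<in> hyp_tangent x" by (simp add: g hyp_tangent_def lorentz_linear q xx)
  have "lorentz ?g ?g = 1"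
    by (simp add: g lorentz_linear q xx n) (simp add: field_simps power2_eq_square[symmetric] cosh_square_eq)
  then show nn: "hyp_norm ?g = 1" by (simp add: hyp_norm_def)
  have "a + lorentz ?g v \<le> halfspace_dist n (hyp_exp x v)" if v: "v \<in> hyp_tangent x" for v
  proof (cases "a + lorentz ?g v \<ge> 0")
    case True
    define b where "b = hyp_norm v"
    have "\<bar>lorentz ?g v\<bar> \<le> b" using lorentz_Cauchy_Schwarz[OF x gt v] by (simp add: b_def nn)
    then have "sinh (a + lorentz ?g v) \<le> sinh a * cosh b + cosh a * (sinh b / b * lorentz ?g v)"
      by (rule sinh_add_le[OF True a0])
    also have "\<dots> = sinh a * cosh b + sinh b / b * (cosh a * lorentz ?g v)" by (simp only: ac_simps)
    also have "cosh a * lorentz ?g v = lorentz n v"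
      using v by (simp add: g lorentz_linear hyp_tangent_def)
    also have "sinh a * cosh b + sinh b / b * lorentz n v = lorentz n (hyp_exp x v)"
      by (simp add: lorentz_hyp_exp_right b_def[symmetric] q)
    finally have "a + lorentz ?g v \<le> arsinh (lorentz n (hyp_exp x v))"
      by (metis sinh_real_le_iff sinh_arsinh_real)
    then show ?thesis by (simp add: halfspace_dist_def)
  qed (simp add: halfspace_dist_def)
  moreover have "halfspace_dist n x = a" using a0 by (simp add: halfspace_dist_def a_def)
  ultimately show "?g \<in> hyp_subdifferential (halfspace_dist n) x"
    by (simp add: mem_hyp_subdifferential_iff[OF x] gt)
qed

section \<open>Existence of Polyak steps\<close>

lemma obtain_tanh:
  fixes w :: real
  assumes "0 < w" "w < 1"
  obtains t where "0 < t" "tanh t = w"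
proof -
  define y where "y = sqrt ((1 + w) / (1 - w))"
  have y: "0 < y" "y^2 = (1 + w) / (1 - w)" using assms by (auto simp: y_def)
  have "tanh (ln y) = (y^2 - 1) / (y^2 + 1)" using y(1) by (rule tanh_ln_real)
  also have "\<dots> = w" using assms unfolding y(2) by (simp add: field_simps)
  finally have t: "tanh (ln y) = w" .
  then show ?thesis using that assms(1) tanh_real_pos_iff[of "ln y"] by blast
qed

text \<open>\<open>t\<close> is the length of the step. The relation for \<open>cosh s'\<close> is
  the hyperbolic Pythagorean theorem with the old radius \<open>s\<close> as hypotenuse.\<close>

lemma polyak_step_exists:
  fixes x g :: "real \<times> 'a::euclidean_space" and \<kappa> :: real
  assumes o: "orc x = (fx, g)" and s: "0 < s" and G: "0 < hyp_norm g"
    and \<kappa>: "\<kappa> = (fx - fstar) / (s * hyp_norm g)" "0 < \<kappa>" "\<kappa> < 1"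
  obtains t s' where "0 < t" "tanh t = \<kappa> * tanh s" "0 < s'" "cosh s' = cosh s / cosh t"
    "polyak_step fstar orc x s (cosh t *\<^sub>R x - (sinh t / hyp_norm g) *\<^sub>R g) s'"
proof -
  have ts: "0 < tanh s" "tanh s < 1" using s tanh_real_lt_1 by auto
  have "\<kappa> * tanh s < 1 * 1" using \<kappa> ts by (intro mult_strict_mono) auto
  then obtain t where t: "0 < t" "tanh t = \<kappa> * tanh s"
    using obtain_tanh[of "\<kappa> * tanh s"] mult_pos_pos[OF \<kappa>(2) ts(1)] by auto
  have \<kappa>2: "\<kappa>^2 < 1" using \<kappa> by (simp add: power_less_one_iff)
  \<comment> \<open>Solves the sine equation of \<open>polyak_step\<close>, with
    \<open>sin \<theta> = sqrt (1 - \<kappa>^2)\<close>.\<close>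
  define s' where "s' = arsinh (sinh s * sqrt (1 - \<kappa>^2))"
  define \<theta> where "\<theta> = arccos \<kappa>"
  have s': "0 < s'" using s \<kappa>2 by (simp add: s'_def)
  have "(cosh s)^2 * (tanh t)^2 = \<kappa>^2 * (sinh s)^2"
    unfolding t(2) by (simp add: tanh_def power_mult_distrib power_divide)
  then have "(cosh s')^2 = (cosh s)^2 * (1 - (tanh t)^2)"
    using \<kappa>2 cosh_square_eq[of s]
    unfolding cosh_square_eq[of s'] by (simp add: s'_def power_mult_distrib algebra_simps)
  also have "\<dots> = (cosh s / cosh t)^2" by (simp add: one_minus_tanh_square power_divide)
  finally have cs: "cosh s' = cosh s / cosh t" by (simp add: power2_eq_iff_nonneg)
  have \<theta>: "cos \<theta> = \<kappa>" "sin \<theta> = sqrt (1 - \<kappa>^2)" "0 < \<theta>" "\<theta> < pi / 2"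
    using \<kappa> arccos_lt_bounded[of \<kappa>] arccos_less_arccos[of 0 \<kappa>]
    by (auto simp: \<theta>_def sin_arccos)
  have "polyak_step fstar orc x s (cosh t *\<^sub>R x - (sinh t / hyp_norm g) *\<^sub>R g) s'"
    unfolding polyak_step_def
  proof (intro exI conjI)
    show "orc x = (fx, g)" by (rule o)
    show "0 < \<theta>" "\<theta> < pi / 2" by (fact \<theta>)+
    show "0 < t / hyp_norm g" using t G by simp
    show "cos \<theta> = (fx - fstar) / (s * hyp_norm g)" using \<theta> \<kappa> by simp
    show "cos \<theta> = tanh (t / hyp_norm g * hyp_norm g) / tanh s" using \<theta> t ts G by simp
    show "sin \<theta> = sinh s' / sinh s" using \<theta> s by (simp add: s'_def)
    show "cosh t *\<^sub>R x - (sinh t / hyp_norm g) *\<^sub>R g = hyp_exp x (- (t / hyp_norm g) *\<^sub>R g)"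
      unfolding hyp_exp_scaleR using G by simp
  qed
  then show ?thesis using that t s' cs by blast
qed

text \<open>
  The ball of radius \<open>s\<close> stays strictly larger than the distance \<open>D\<close> to the minimizer: after
  \<open>s tanh D \<ge> D tanh s\<close> the claim becomes \<open>cosh (s - D) > 1\<close>.
\<close>

lemma polyak_slack:
  fixes D s c t :: real
  assumes D: "0 < D" "D < s" and c: "0 < c" "c < 1" and t: "tanh t = c * D / s * tanh s"
  shows "cosh t * cosh D - c * sinh t * sinh D < cosh s / cosh t"
proof -
  define \<tau> where "\<tau> = D / s * tanh s"
  have s: "0 < s" using D by simp
  have \<tau>: "0 < \<tau>" "\<tau> \<le> tanh D" using tanh_mult_le[of D s] D by (auto simp: \<tau>_def field_simps)
  have ts: "\<tau> * cosh s = D / s * sinh s" by (simp add: \<tau>_def tanh_def)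
  \<comment> \<open>The claim divided by \<open>cosh t\<close>, after
    \<open>sinh t = c * \<tau> * cosh t\<close> and
    \<open>1 / (cosh t)^2 = 1 - (c * \<tau>)^2\<close>.\<close>
  have key: "c^2 * \<tau> * (\<tau> * cosh s - sinh D) < cosh s - cosh D"
  proof (cases "\<tau> * cosh s \<le> sinh D")
    case True
    then have "c^2 * \<tau> * (\<tau> * cosh s - sinh D) \<le> 0" using \<tau> c by (intro mult_nonneg_nonpos) auto
    also have "0 < cosh s - cosh D" using D by (simp add: cosh_real_nonneg_less_iff)
    finally show ?thesis .
  next
    case False
    have "c^2 * \<tau> \<le> 1 * tanh D"
      using \<tau> c by (intro mult_mono) (auto simp: power_le_one)
    then have "c^2 * \<tau> * (\<tau> * cosh s - sinh D) \<le> tanh D * (\<tau> * cosh s - sinh D)"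
      using False by (intro mult_right_mono) auto
    moreover have "cosh D * (tanh D * (\<tau> * cosh s - sinh D)) < cosh D * (cosh s - cosh D)"
    proof -
      have "D / s * sinh s * sinh D \<le> 1 * sinh s * sinh D"
        using D by (intro mult_right_mono) auto
      moreover have "1 < cosh (s - D)" using D cosh_real_nonneg_less_iff[of 0 "s - D"] by simp
      ultimately have "sinh D * (D / s * sinh s) - sinh D * sinh D < cosh D * cosh s - cosh D * cosh D"
        using cosh_square_eq[of D] by (simp add: cosh_diff power2_eq_square algebra_simps)
      then show ?thesis unfolding ts by (simp add: tanh_def algebra_simps)
    qed
    ultimately show ?thesis by (simp add: mult_less_cancel_left_pos)
  qed
  have tt: "tanh t = c * \<tau>" using t by (simp add: \<tau>_def)
  have st: "sinh t = c * \<tau> * cosh t" using tt by (simp add: tanh_def field_simps)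
  have "1 - (c * \<tau>)^2 = 1 / (cosh t)^2" using one_minus_tanh_square[of t] tt by simp
  then have cc: "cosh s / cosh t = cosh t * (cosh s * (1 - (c * \<tau>)^2))"
    by (simp add: power2_eq_square)
  have "cosh D - c * (c * \<tau>) * sinh D < cosh s * (1 - (c * \<tau>)^2)"
    using key by (simp add: algebra_simps power2_eq_square)
  then have "cosh t * (cosh D - c * (c * \<tau>) * sinh D) < cosh t * (cosh s * (1 - (c * \<tau>)^2))"
    by simp
  then show ?thesis unfolding cc st by (simp add: algebra_simps)
qed

section \<open>The hard function, its oracle and the run\<close>

locale polyak_adversary =
  fixes z :: "real \<times> 'a::euclidean_space" and n :: "nat \<Rightarrow> real \<times> 'a" and N :: nat
    and c \<sigma> C :: real
  assumes z: "z \<in> hyp_space"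
    and nz: "k < N \<Longrightarrow> lorentz (n k) z = 0"
    and nn: "j < N \<Longrightarrow> k < N \<Longrightarrow> lorentz (n j) (n k) = (if j = k then 1 else 0)"
    and c: "0 < c" "c < 1" and \<sigma>: "0 < \<sigma>" "c^2 + \<sigma>^2 = 1" and C: "0 < C"
begin

definition excess :: "real \<times> 'a \<Rightarrow> real" where
  "excess y = Max (insert 0 ((\<lambda>k. halfspace_dist (n k) y) ` {..<N}))"

definition hard :: "real \<times> 'a \<Rightarrow> real" where
  "hard y = C * c * hyp_dist z y + C * \<sigma> * excess y"

text \<open>The sign condition discards half-spaces with \<open>x\<close> in their interior: their
  distance \<open>0\<close> may equal \<open>excess x\<close>, but
  \<open>halfspace_subgradient\<close> is not a subgradient there.\<close>

definition active :: "real \<times> 'a \<Rightarrow> nat set" where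
  "active x = {k. k < N \<and> 0 \<le> lorentz (n k) x \<and> halfspace_dist (n k) x = excess x}"

text \<open>Breaking ties by the least index makes the run consume the normals in order, one per
  step.\<close>

definition excess_subgradient :: "real \<times> 'a \<Rightarrow> real \<times> 'a" where
  "excess_subgradient x =
    (if active x = {} then 0 else halfspace_subgradient (n (LEAST k. k \<in> active x)) x)"

definition hard_subgradient :: "real \<times> 'a \<Rightarrow> real \<times> 'a" where
  "hard_subgradient x = (C * c) *\<^sub>R dist_subgradient z x + (C * \<sigma>) *\<^sub>R excess_subgradient x"

lemma excess_ge: "0 \<le> excess y" "k < N \<Longrightarrow> halfspace_dist (n k) y \<le> excess y"
  by (auto simp: excess_def intro!: Max_ge)

lemma excess_eq_0:
  assumes "\<And>k. k < N \<Longrightarrow> lorentz (n k) y \<le> 0"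
  shows "excess y = 0"
proof -
  have "halfspace_dist (n k) y = 0" if "k < N" for k
    using assms[OF that] arsinh_real_pos_iff[of "lorentz (n k) y"]
    by (simp add: halfspace_dist_def max_absorb1 not_less[symmetric])
  then have "insert 0 ((\<lambda>k. halfspace_dist (n k) y) ` {..<N}) = {0}" by auto
  then show ?thesis by (simp only: excess_def Max_singleton)
qed

lemma excess_subgradient:
  assumes x: "x \<in> hyp_space"
  shows "excess_subgradient x \<in> hyp_subdifferential excess x" "hyp_norm (excess_subgradient x) \<le> 1"
proof -
  have "excess_subgradient x \<in> hyp_subdifferential excess x \<and> hyp_norm (excess_subgradient x) \<le> 1"
  proof (cases "active x = {}")
    case True
    \<comment> \<open>A positive maximum would be attained at an active index. Hence
      \<open>x\<close> minimizes \<open>excess\<close>, and \<open>0\<close> is a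
      subgradient.\<close>
    have "excess x = 0"
    proof (rule ccontr)
      assume ne: "excess x \<noteq> 0"
      have "excess x \<in> insert 0 ((\<lambda>k. halfspace_dist (n k) x) ` {..<N})"
        unfolding excess_def by (intro Max_in) auto
      then obtain k where k: "k < N" "halfspace_dist (n k) x = excess x" using ne by auto
      then have "0 < arsinh (lorentz (n k) x)"
        using ne excess_ge(1)[of x] unfolding halfspace_dist_def by linarith
      then have "k \<in> active x" using k by (simp add: active_def)
      then show False using True by simp
    qed
    then show ?thesis using True excess_ge(1)
      by (auto simp: excess_subgradient_def hyp_norm_def intro!: zero_mem_hyp_subdifferential)
  next
    case False
    define k where "k = (LEAST k. k \<in> active x)"
    have "k \<in> active x" using False unfolding k_def by (metis LeastI ex_in_conv)
    then have k: "k < N" "0 \<le> lorentz (n k) x" "halfspace_dist (n k) x = excess x"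
      by (auto simp: active_def)
    have n1: "lorentz (n k) (n k) = 1" using nn k by simp
    have e: "excess_subgradient x = halfspace_subgradient (n k) x"
      using False by (simp add: excess_subgradient_def k_def)
    show ?thesis unfolding e using halfspace_subgradient[OF x n1 k(2)] excess_ge(2)[OF k(1)] k(3)
      by (auto intro: hyp_subdifferential_mono)
  qed
  then show "excess_subgradient x \<in> hyp_subdifferential excess x" "hyp_norm (excess_subgradient x) \<le> 1"
    by auto
qed

text \<open>The norm bound will give the Lipschitz constant. In the steps that consume a normal the
  two parts are orthogonal and the norm is only \<open>C\<close>.\<close>

lemma hard_subgradient:
  assumes x: "x \<in> hyp_space"
  shows "hard_subgradient x \<in> hyp_subdifferential hard x"
    and "hyp_norm (hard_subgradient x) \<le> C * (c + \<sigma>)"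
proof -
  show "hard_subgradient x \<in> hyp_subdifferential hard x"
    unfolding hard_subgradient_def hard_def[abs_def]
    using dist_subgradient(1)[OF z x] excess_subgradient(1)[OF x] C c \<sigma>
    by (intro hyp_subdifferential_combination) auto
  have t: "dist_subgradient z x \<in> hyp_tangent x" "excess_subgradient x \<in> hyp_tangent x"
    using dist_subgradient(1)[OF z x] excess_subgradient(1)[OF x] by (auto simp: hyp_subdifferential_def)
  have "hyp_norm (hard_subgradient x) \<le>
      C * c * hyp_norm (dist_subgradient z x) + C * \<sigma> * hyp_norm (excess_subgradient x)"
    using hyp_norm_triangle[OF x hyp_tangent_linear(3)[OF t(1), of "C * c"] hyp_tangent_linear(3)[OF t(2), of "C * \<sigma>"]]
      C c \<sigma> by (simp add: hard_subgradient_def hyp_norm_scaleR)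
  also have "\<dots> \<le> C * c * 1 + C * \<sigma> * 1"
    using dist_subgradient(2)[OF z x] excess_subgradient(2)[OF x] C c \<sigma>
    by (intro add_mono mult_left_mono) auto
  finally show "hyp_norm (hard_subgradient x) \<le> C * (c + \<sigma>)" by (simp add: algebra_simps)
qed

lemma hard_nonneg:
  assumes "y \<in> hyp_space"
  shows "0 \<le> hard y"
  using C c \<sigma> excess_ge(1) cosh_hyp_dist(2)[OF z assms] by (simp add: hard_def)

lemma hard_minimizer: "hard z = 0"
proof -
  have "hyp_dist z z = 0" using z by (simp add: hyp_dist_def hyp_space_def)
  then show ?thesis using nz by (simp add: hard_def excess_eq_0)
qed

text \<open>The invariant before step \<open>k\<close>: the first \<open>k\<close> normals are
  consumed. The strict bound by \<open>s\<close> keeps the cosine of the next step below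
  \<open>1\<close>.\<close>

definition stage :: "nat \<Rightarrow> real \<times> 'a \<Rightarrow> real \<Rightarrow> bool" where
  "stage k x s \<longleftrightarrow> x \<in> hyp_space \<and> 0 < hyp_dist z x \<and> hyp_dist z x < s \<and>
    (\<forall>j<N. if j < k then lorentz (n j) x < 0 else lorentz (n j) x = 0)"

lemma stage_hard:
  assumes "stage k x s"
  shows "excess x = 0" "hard x = C * c * hyp_dist z x"
proof -
  show "excess x = 0"
    using assms by (intro excess_eq_0) (fastforce simp: stage_def split: if_splits)
  then show "hard x = C * c * hyp_dist z x" by (simp add: hard_def)
qed

lemma stage_active:
  assumes "stage k x s"
  shows "active x = {k..<N}"
proof -
  have "j \<in> active x \<longleftrightarrow> k \<le> j \<and> j < N" for j
  proof (cases "j < N")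
    case True
    then have "if j < k then lorentz (n j) x < 0 else lorentz (n j) x = 0"
      using assms by (simp add: stage_def)
    then show ?thesis using True stage_hard(1)[OF assms]
      by (auto simp: active_def halfspace_dist_def not_less split: if_splits)
  qed (simp add: active_def)
  then show ?thesis by (simp add: set_eq_iff)
qed

definition adversary :: "'a first_order_oracle" where
  "adversary x = (hard x, hard_subgradient x)"

lemma is_oracle_adversary: "is_oracle hard adversary"
  using hard_subgradient(1) by (simp add: is_oracle_def adversary_def)

text \<open>By orthogonality, the product of the new point with \<open>n j\<close> stays
  \<open>0\<close> for \<open>j > k\<close>, becomes \<open>- \<sigma> * sinh t\<close> for
  \<open>j = k\<close>, and is a positive multiple of the old one for \<open>j < k\<close>.\<close>

lemma stage_step:
  assumes st: "stage k x s" and k: "k < N"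
  obtains x' s' where "polyak_step 0 adversary x s x' s'" "stage (Suc k) x' s'"
    "\<sigma> * sinh (hyp_dist z x) \<le> sinh (hyp_dist z x')"
proof -
  define D where "D = hyp_dist z x"
  define \<gamma> where "\<gamma> = dist_subgradient z x"
  have x: "x \<in> hyp_space" and D: "0 < D" "D < s"
    and nx: "\<And>j. j < N \<Longrightarrow> j < k \<Longrightarrow> lorentz (n j) x < 0" "\<And>j. j < N \<Longrightarrow> k \<le> j \<Longrightarrow> lorentz (n j) x = 0"
    using st by (auto simp: stage_def D_def)
  have s: "0 < s" using D by simp
  have cd: "lorentz z x = - cosh D" using cosh_hyp_dist[OF z x] by (simp add: D_def)
  have "excess_subgradient x = halfspace_subgradient (n k) x"
  proof -
    have "(LEAST j. j \<in> active x) = k"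
      using k by (intro Least_equality) (auto simp: stage_active[OF st])
    then show ?thesis using k by (simp add: excess_subgradient_def stage_active[OF st])
  qed
  then have g: "hard_subgradient x = C *\<^sub>R (c *\<^sub>R \<gamma> + \<sigma> *\<^sub>R n k)"
    using nx(2)[OF k] by (simp add: hard_subgradient_def \<gamma>_def halfspace_subgradient_def algebra_simps)
  \<comment> \<open>Only the \<open>x\<close> part of \<open>\<gamma>\<close> contributes, since
    \<open>n j\<close> is orthogonal to \<open>z\<close>.\<close>
  have n\<gamma>: "lorentz (n j) \<gamma> = cosh D / sinh D * lorentz (n j) x" if "j < N" for j
    using nz[OF that] by (simp add: \<gamma>_def dist_subgradient_def D_def lorentz_linear)
  have \<gamma>1: "lorentz \<gamma> \<gamma> = 1"
    using dist_subgradient(3)[OF z x] D by (simp add: hyp_norm_def D_def \<gamma>_def)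
  have \<gamma>n: "lorentz (n k) \<gamma> = 0" "lorentz \<gamma> (n k) = 0"
    using n\<gamma>[OF k] nx(2)[OF k] lorentz_algebra(1)[of \<gamma> "n k"] by auto
  have "hyp_norm (c *\<^sub>R \<gamma> + \<sigma> *\<^sub>R n k) = 1"
    using \<gamma>n nn[OF k k] \<gamma>1 \<sigma> by (simp add: hyp_norm_def lorentz_linear power2_eq_square)
  then have gn: "hyp_norm (hard_subgradient x) = C" using C unfolding g hyp_norm_scaleR by simp
  have \<kappa>: "c * D / s = (hard x - 0) / (s * hyp_norm (hard_subgradient x))"
    using C stage_hard(2)[OF st] by (simp add: gn D_def)
  have "c * D < 1 * s" using c D by (intro mult_strict_mono) auto
  then have \<kappa>1: "0 < c * D / s" "c * D / s < 1" using c D by (auto simp: field_simps)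
  have "0 < hyp_norm (hard_subgradient x)" using gn C by simp
  from polyak_step_exists[where fstar = 0 and x = x and orc = adversary, OF adversary_def s this \<kappa> \<kappa>1]
  obtain t s' where t: "0 < t" "tanh t = c * D / s * tanh s" and s': "0 < s'" "cosh s' = cosh s / cosh t"
    and step: "polyak_step 0 adversary x s (cosh t *\<^sub>R x - (sinh t / hyp_norm (hard_subgradient x)) *\<^sub>R hard_subgradient x) s'"
    by blast
  define x' where "x' = cosh t *\<^sub>R x - sinh t *\<^sub>R (c *\<^sub>R \<gamma> + \<sigma> *\<^sub>R n k)"
  have step': "polyak_step 0 adversary x s x' s'"
    using step C unfolding gn unfolding g by (simp add: x'_def)
  have "hard_subgradient x \<in> hyp_tangent x"
    using hard_subgradient(1)[OF x] by (simp add: hyp_subdifferential_def)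
  moreover obtain \<eta> where "x' = hyp_exp x (- \<eta> *\<^sub>R hard_subgradient x)"
    using step' by (auto simp: polyak_step_def adversary_def)
  ultimately have x': "x' \<in> hyp_space"
    using hyp_exp_in_hyp_space[OF x hyp_tangent_linear(3)] by blast
  define D' where "D' = hyp_dist z x'"
  have D'0: "0 \<le> D'" using cosh_hyp_dist[OF z x'] by (simp add: D'_def)
  have zn: "lorentz z (n k) = 0" using nz[OF k] lorentz_algebra(1)[of z "n k"] by simp
  have z\<gamma>: "lorentz z \<gamma> = - sinh D" using dist_subgradient(4)[OF z x] by (simp add: \<gamma>_def D_def)
  have cD': "cosh D' = cosh t * cosh D - c * sinh t * sinh D"
    using cosh_hyp_dist(1)[OF z x'] by (simp add: D'_def x'_def lorentz_linear zn z\<gamma> cd algebra_simps)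
  have "cosh D' < cosh s'" unfolding cD' s'(2) by (rule polyak_slack[OF D c t(2)])
  then have D's': "D' < s'" using D'0 s'(1) cosh_real_nonneg_less_iff[of D' s'] by simp
  text \<open>The geodesic through \<open>x\<close> with direction \<open>\<gamma>\<close> turned by \<open>arccos c\<close> has distance
    \<open>arsinh (\<sigma> sinh D)\<close> from \<open>z\<close>.\<close>
  have "(cosh D')^2 = (cosh D)^2 - c^2 * (sinh D)^2 + (cosh D * sinh t - c * sinh D * cosh t)^2"
    using cosh_square_eq[of t] unfolding cD'
    by (simp add: power2_eq_square algebra_simps) algebra
  also have "(cosh D)^2 - c^2 * (sinh D)^2 = 1 + (\<sigma> * sinh D)^2"
    using \<sigma>(2) cosh_square_eq[of D] by (simp add: power_mult_distrib) algebra
  finally have "(\<sigma> * sinh D)^2 \<le> (sinh D')^2" by (simp add: cosh_square_eq)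
  then have sD': "\<sigma> * sinh D \<le> sinh D'" by (rule power2_le_imp_le) (use D'0 in simp)
  moreover have "0 < \<sigma> * sinh D" using \<sigma> D by simp
  ultimately have D'pos: "0 < D'" using sinh_real_pos_iff[of D'] by linarith
  have nx': "lorentz (n j) x' = (cosh t - c * sinh t * (cosh D / sinh D)) * lorentz (n j) x
      - sinh t * \<sigma> * (if j = k then 1 else 0)" if "j < N" for j
    using n\<gamma>[OF that] nn[OF that k] by (simp add: x'_def lorentz_linear algebra_simps)
  \<comment> \<open>Equivalent to \<open>c * tanh t < tanh D\<close>, which holds since the step
    rule gives \<open>tanh t \<le> c * tanh D\<close>. Thus \<open>x'\<close> does not cross the
    earlier hyperplanes.\<close>
  have coef: "0 < cosh t - c * sinh t * (cosh D / sinh D)"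
  proof -
    have "c * tanh t = c^2 * (D / s * tanh s)" using t by (simp add: power2_eq_square)
    also have "\<dots> \<le> c^2 * tanh D"
      using tanh_mult_le[of D s] D by (intro mult_left_mono) (auto simp: field_simps)
    also have "\<dots> < 1 * tanh D" using c D by (intro mult_strict_right_mono) (auto simp: power_less_one_iff)
    finally show ?thesis using D by (simp add: tanh_def field_simps)
  qed
  have "stage (Suc k) x' s'"
    unfolding stage_def
  proof (intro conjI allI impI)
    fix j assume j: "j < N"
    consider "j < k" | "j = k" | "k < j" by linarith
    then show "if j < Suc k then lorentz (n j) x' < 0 else lorentz (n j) x' = 0"
    proof cases
      case 1
      then show ?thesis using nx'[OF j] nx(1)[OF j 1] coef by (simp add: mult_pos_neg)
    next
      case 2
      then show ?thesis using nx'[OF j] nx(2)[OF j] t \<sigma> by simp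
    next
      case 3
      then show ?thesis using nx'[OF j] nx(2)[OF j] by simp
    qed
  qed (use x' D'pos D's' in \<open>simp_all add: D'_def\<close>)
  then show ?thesis using that step' sD' by (simp add: D_def D'_def)
qed

text \<open>With all normals consumed only the distance term contributes, and the cosine is
  \<open>D / s\<close>. The new point needs no bound: the run is estimated only up to index
  \<open>N\<close>.\<close>

lemma last_step:
  assumes st: "stage N x s"
  obtains x' s' where "polyak_step 0 adversary x s x' s'"
proof -
  define D where "D = hyp_dist z x"
  have x: "x \<in> hyp_space" and D: "0 < D" "D < s" using st by (auto simp: stage_def D_def)
  have "hard_subgradient x = (C * c) *\<^sub>R dist_subgradient z x"
    by (simp add: hard_subgradient_def excess_subgradient_def stage_active[OF st])
  then have gn: "hyp_norm (hard_subgradient x) = C * c"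
    using dist_subgradient(3)[OF z x] D C c by (simp add: hyp_norm_scaleR D_def)
  have \<kappa>: "D / s = (hard x - 0) / (s * hyp_norm (hard_subgradient x))"
    using C c stage_hard(2)[OF st] by (simp add: gn D_def)
  have "0 < D / s" "D / s < 1" "0 < s" "0 < hyp_norm (hard_subgradient x)"
    using D gn C c by auto
  from polyak_step_exists[where fstar = 0 and x = x and orc = adversary, OF adversary_def this(3,4) \<kappa> this(1,2)] show ?thesis using that by blast
qed

lemma polyak_run_exists:
  assumes "stage 0 x0 r"
  shows "\<exists>x s. polyak_run 0 adversary x0 r (Suc N) x s \<and>
    (\<forall>k\<le>N. C * c * arsinh (\<sigma>^k * sinh (hyp_dist z x0)) \<le> hard (x k))"
proof -
  \<comment> \<open>\<open>P\<close> holds trivially beyond \<open>N\<close>, so dependent choice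
    over all naturals applies; \<open>Q\<close> still covers step \<open>N\<close>, supplied by
    \<open>last_step\<close>.\<close>
  define P where "P = (\<lambda>k (x, s). (k = 0 \<longrightarrow> x = x0 \<and> s = r) \<and>
    (k \<le> N \<longrightarrow> stage k x s \<and> \<sigma>^k * sinh (hyp_dist z x0) \<le> sinh (hyp_dist z x)))"
  define Q where "Q = (\<lambda>k (x, s) (x', s'). k \<le> N \<longrightarrow> polyak_step 0 adversary x s x' s')"
  have "\<exists>f. \<forall>k. P k (f k) \<and> Q k (f k) (f (Suc k))"
  proof (rule dependent_nat_choice)
    show "\<exists>p. P 0 p" using assms by (intro exI[of _ "(x0, r)"]) (simp add: P_def)
  next
    fix p k assume p: "P k p"
    obtain x s where xs: "p = (x, s)" by (cases p)
    consider "k < N" | "k = N" | "N < k" by linarith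
    then show "\<exists>q. P (Suc k) q \<and> Q k p q"
    proof cases
      case 1
      then have st: "stage k x s" and le: "\<sigma>^k * sinh (hyp_dist z x0) \<le> sinh (hyp_dist z x)"
        using p by (auto simp: P_def xs)
      obtain x' s' where step: "polyak_step 0 adversary x s x' s'" "stage (Suc k) x' s'"
        "\<sigma> * sinh (hyp_dist z x) \<le> sinh (hyp_dist z x')"
        using stage_step[OF st 1] by blast
      have "\<sigma> * (\<sigma>^k * sinh (hyp_dist z x0)) \<le> \<sigma> * sinh (hyp_dist z x)"
        using le \<sigma> by (intro mult_left_mono) auto
      then show ?thesis using step
        by (intro exI[of _ "(x', s')"]) (simp add: P_def Q_def xs mult.assoc)
    next
      case 2
      then have "stage N x s" using p by (auto simp: P_def xs)
      then obtain x' s' where "polyak_step 0 adversary x s x' s'" by (rule last_step)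
      then show ?thesis using 2 by (intro exI[of _ "(x', s')"]) (simp add: P_def Q_def xs)
    next
      case 3
      then show ?thesis by (intro exI[of _ p]) (simp add: P_def Q_def xs)
    qed
  qed
  then obtain f where f: "\<And>k. P k (f k)" "\<And>k. Q k (f k) (f (Suc k))" by blast
  have "polyak_run 0 adversary x0 r (Suc N) (fst \<circ> f) (snd \<circ> f)"
    using f(1)[of 0] f(2) by (auto simp: polyak_run_def P_def Q_def case_prod_beta less_Suc_eq_le)
  moreover have "C * c * arsinh (\<sigma>^k * sinh (hyp_dist z x0)) \<le> hard ((fst \<circ> f) k)" if "k \<le> N" for k
  proof -
    have st: "stage k (fst (f k)) (snd (f k))"
      and "\<sigma>^k * sinh (hyp_dist z x0) \<le> sinh (hyp_dist z (fst (f k)))"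
      using f(1)[of k] that by (auto simp: P_def case_prod_beta)
    then have "arsinh (\<sigma>^k * sinh (hyp_dist z x0)) \<le> hyp_dist z (fst (f k))"
      by (metis sinh_arsinh_real sinh_real_le_iff)
    then show ?thesis using stage_hard(2)[OF st] C c by simp
  qed
  ultimately show ?thesis by blast
qed

end

section \<open>Orthonormal frame and choice of constants\<close>

text \<open>A Lorentz boost carries the standard basis to the tangent space at \<open>x\<close>.\<close>

lemma hyp_tangent_orthonormal_basis:
  fixes x :: "real \<times> 'a::euclidean_space"
  assumes x: "x \<in> hyp_space"
  obtains E where "\<And>k. k < DIM('a) \<Longrightarrow> E k \<in> hyp_tangent x"
    "\<And>j k. j < DIM('a) \<Longrightarrow> k < DIM('a) \<Longrightarrow> lorentz (E j) (E k) = (if j = k then 1 else 0)"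
proof -
  obtain h where h: "bij_betw h {0..<DIM('a)} (Basis :: 'a set)"
    using ex_bij_betw_nat_finite[OF finite_Basis] by blast
  obtain a b where ab: "x = (a, b)" by (cases x)
  have a: "0 < a" "b \<bullet> b = a * a - 1" using x by (auto simp: ab hyp_space_def lorentz_def)
  \<comment> \<open>The boost taking \<open>(1, 0)\<close> to \<open>x = (a, b)\<close>, restricted
    to vectors \<open>(0, u)\<close>.\<close>
  define L where "L u = (b \<bullet> u, u + (b \<bullet> u / (1 + a)) *\<^sub>R b)" for u
  have tangent: "L u \<in> hyp_tangent x" for u
  proof -
    have "lorentz x (L u) = (b \<bullet> u) * (1 + (b \<bullet> b) / (1 + a) - a)"
      by (simp add: ab L_def lorentz_def inner_add_right algebra_simps)
    also have "1 + (b \<bullet> b) / (1 + a) - a = 0" using a by (simp add: field_simps)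
    finally show ?thesis by (simp add: hyp_tangent_def)
  qed
  have isometry: "lorentz (L u) (L v) = u \<bullet> v" for u v
  proof -
    have "lorentz (L u) (L v) = u \<bullet> v + (b \<bullet> u) * (b \<bullet> v) * (2 / (1 + a) + (b \<bullet> b) / (1 + a)^2 - 1)"
      unfolding L_def lorentz_def fst_conv snd_conv inner_add_left inner_add_right inner_scaleR_left inner_scaleR_right
        inner_commute[of u b]
      by (simp add: power2_eq_square algebra_simps)
    also have "2 / (1 + a) + (b \<bullet> b) / (1 + a)^2 - 1 = 0"
      using a by (simp add: divide_simps power2_eq_square) (simp add: algebra_simps)
    finally show ?thesis by simp
  qed
  show ?thesis
  proof (rule that[of "\<lambda>k. L (h k)"])
    fix j k assume jk: "j < DIM('a)" "k < DIM('a)"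
    then have "h j \<in> Basis" "h k \<in> Basis" "h j = h k \<longleftrightarrow> j = k"
      using h by (auto simp: bij_betw_def inj_on_eq_iff)
    then show "lorentz (L (h j)) (L (h k)) = (if j = k then 1 else 0)"
      by (simp add: isometry inner_Basis)
  qed (rule tangent)
qed

lemma curv_zeta_le:
  assumes "0 < r"
  shows "curv_zeta r \<le> 1 + r"
proof -
  have "r * cosh r \<le> (1 + r) * sinh r"
  proof -
    have D: "((\<lambda>t. (1 + t) * sinh t - t * cosh t) has_real_derivative (t * (cosh t - sinh t) + sinh t)) (at t)"
      for t :: real
      by (auto intro!: derivative_eq_intros simp: algebra_simps)
    have "(1 + 0) * sinh 0 - 0 * cosh 0 \<le> (1 + r) * sinh r - r * cosh r"
      by (rule nondecreasing_if_deriv_nonneg[OF D]) (use assms in \<open>auto simp: sinh_le_cosh_real\<close>)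
    then show ?thesis by simp
  qed
  then show ?thesis using assms by (simp add: curv_zeta_def tanh_def field_simps)
qed

text \<open>Ensures \<open>\<rho> < r\<close> in the construction. Doubling the angle in
  \<open>sinh r\<close> leaves \<open>curv_zeta r / 6 < ln A\<close>; by \<open>curv_zeta_le\<close>
  the lower bounds \<open>2 / 3\<close> and \<open>r / 2\<close> for \<open>ln A\<close>
  suffice.\<close>

lemma exp_curv_zeta_less:
  assumes r: "0 < r"
  shows "exp (curv_zeta r / 6) * sinh (r / 2) < sinh r"
proof -
  define A where "A = 2 * cosh (r / 2)"
  have A0: "0 < A" by (simp add: A_def)
  have "2 \<le> A" by (simp add: A_def cosh_real_ge_1)
  then have "2 / 3 \<le> ln A" using ln2_ge_two_thirds ln_mono[of 2 A] by linarith
  moreover have "exp (r / 2) \<le> A" by (simp add: A_def cosh_def)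
  then have "r / 2 \<le> ln A" using A0 ln_ge_iff[of A "r / 2"] by simp
  ultimately have "(1 + r) / 6 < ln A" by simp
  then have "curv_zeta r / 6 < ln A" using curv_zeta_le[OF r] by simp
  then have "exp (curv_zeta r / 6) < A" using A0 by (metis exp_less_cancel_iff exp_ln)
  then have "exp (curv_zeta r / 6) * sinh (r / 2) < A * sinh (r / 2)" using r by simp
  also have "A * sinh (r / 2) = sinh r" using sinh_double[of "r / 2"] by (simp add: A_def)
  finally show ?thesis .
qed

text \<open>Bounds \<open>\<sigma>\<close> from below, with \<open>x = c^2\<close>. After squaring,
  \<open>exp u \<ge> 1 + u\<close> reduces it to \<open>(1 + u) * (1 - x) \<ge> 1\<close>, where
  \<open>x \<le> 1 / 4\<close> enters.\<close>

lemma exp_neg_le_sqrt: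
  fixes x :: real
  assumes "0 \<le> x" "x \<le> 1 / 4"
  shows "exp (- (2 / 3) * x) \<le> sqrt (1 - x)"
proof (rule real_le_rsqrt)
  define u where "u = 4 / 3 * x"
  have u: "0 \<le> u" "u \<le> 1 / 3" "x = 3 / 4 * u" using assms by (auto simp: u_def)
  have "u * (3 * u) \<le> u * 1" using u by (intro mult_left_mono) auto
  then have le: "1 \<le> (1 + u) * (1 - x)" unfolding u(3) by (simp add: algebra_simps)
  have "(exp (- (2 / 3) * x))^2 = exp (- u)" by (simp add: u_def power2_eq_square flip: exp_add)
  also have "\<dots> = 1 / exp u" by (simp add: exp_minus field_simps)
  also have "\<dots> \<le> 1 / (1 + u)" using u exp_ge_add_one_self[of u] by (intro divide_left_mono) auto
  also have "\<dots> \<le> 1 - x" using le u(1) pos_divide_le_eq[of "1 + u" 1 "1 - x"] by (simp only: mult.commute)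
  finally show "(exp (- (2 / 3) * x))^2 \<le> 1 - x" .
qed

theorem corollary14:
  fixes r \<epsilon> M :: real and T :: nat and xref :: "real \<times> 'a::euclidean_space"
  assumes "r > 0"
    and "0 < \<epsilon>" and "\<epsilon> \<le> 1 / (4 * sqrt 2)"
    and "M > 0"
    and "int T = \<lfloor>1 / 32 * (curv_zeta r / \<epsilon>\<^sup>2)\<rfloor>"
    and "DIM('a) = T"
    and "xref \<in> hyp_space"
  shows "\<exists>f :: real \<times> 'a \<Rightarrow> real.
    g_convex f \<and> hyp_lipschitz M f \<and>
    (\<exists>xstar \<in> hyp_cball xref r. (\<forall>y \<in> hyp_space. f xstar \<le> f y) \<and>
      (\<exists>orc. is_oracle f orc \<and>
        (\<exists>x s. polyak_run (f xstar) orc xref r T x s \<and>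
          (\<forall>k<T. f (x k) - f xstar \<ge> \<epsilon> * M * r))))"
proof -
  note r = assms(1) and \<epsilon> = assms(2,3) and M = assms(4) and T = assms(5) and xref = assms(7)
  \<comment> \<open>\<open>E N\<close> is spent on the direction of \<open>z\<close>; the vectors
    \<open>E k\<close> with \<open>k < N\<close> serve as normals.\<close>
  define N where "N = T - 1"
  have TN: "T = Suc N" "DIM('a) = Suc N" using assms(6) DIM_positive[where 'a='a] by (auto simp: N_def)
  obtain E where E: "\<And>k. k < DIM('a) \<Longrightarrow> E k \<in> hyp_tangent xref"
    "\<And>j k. j < DIM('a) \<Longrightarrow> k < DIM('a) \<Longrightarrow> lorentz (E j) (E k) = (if j = k then 1 else 0)"
    using hyp_tangent_orthonormal_basis[OF xref] by blast
  \<comment> \<open>\<open>C\<close> yields Lipschitz constant \<open>M\<close> because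
    \<open>c + \<sigma> \<le> sqrt 2\<close>, and \<open>c\<close> is such that
    \<open>C * c * (r / 2) = \<epsilon> * M * r\<close>.\<close>
  define C c \<sigma> where "C = M / sqrt 2" and "c = 2 * sqrt 2 * \<epsilon>" and "\<sigma> = sqrt (1 - c^2)"
  have "c \<le> 1 / 2" using \<epsilon> by (simp add: c_def field_simps)
  then have c_pos: "0 < c" "c < 1" and c_sq: "c^2 \<le> 1 / 4"
    using \<epsilon> power_mono[of c "1 / 2" 2] by (auto simp: c_def power2_eq_square)
  have c2: "c^2 = 8 * \<epsilon>^2" by (simp add: c_def power_mult_distrib)
  have \<sigma>: "0 < \<sigma>" "c^2 + \<sigma>^2 = 1" using c_sq by (auto simp: \<sigma>_def)
  have C: "0 < C" using M by (simp add: C_def)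
  define \<rho> where "\<rho> = arsinh (exp (curv_zeta r / 6) * sinh (r / 2))"
  have \<rho>: "0 < \<rho>" "\<rho> < r"
    using exp_curv_zeta_less[OF r] r arsinh_less_iff_real[of _ "sinh r"]
    by (auto simp: \<rho>_def arsinh_sinh_real simp del: arsinh_less_iff_real)
  define z where "z = hyp_exp xref (\<rho> *\<^sub>R E N)"
  have EN: "\<rho> *\<^sub>R E N \<in> hyp_tangent xref" using E(1) TN by (simp add: hyp_tangent_linear)
  have "hyp_norm (\<rho> *\<^sub>R E N) = \<rho>" using E(2) TN \<rho> by (simp add: hyp_norm_scaleR) (simp add: hyp_norm_def)
  then have d: "hyp_dist xref z = \<rho>" using hyp_dist_hyp_exp[OF xref EN] by (simp add: z_def)
  then have d': "hyp_dist z xref = \<rho>" by (simp add: hyp_dist_def lorentz_algebra(1)[of z xref])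
  have z: "z \<in> hyp_space" using hyp_exp_in_hyp_space[OF xref EN] by (simp add: z_def)
  have Ex: "lorentz (E k) xref = 0" if "k < DIM('a)" for k
    using E(1)[OF that] lorentz_algebra(1)[of xref "E k"] by (simp add: hyp_tangent_def)
  interpret polyak_adversary z E N c \<sigma> C
  proof
    show "lorentz (E k) z = 0" if "k < N" for k
      using that E(2)[of k N] Ex[of k] TN by (simp add: z_def lorentz_hyp_exp_right lorentz_linear)
  qed (use z E(2) TN c_pos \<sigma> C in auto)
  have "stage 0 xref r" using xref d' \<rho> Ex TN by (simp add: stage_def)
  from polyak_run_exists[OF this] obtain x s where run: "polyak_run 0 adversary xref r T x s"
    and low: "\<And>k. k \<le> N \<Longrightarrow> C * c * arsinh (\<sigma>^k * sinh \<rho>) \<le> hard (x k)"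
    unfolding d' TN by blast
  have "c + \<sigma> \<le> sqrt 2"
    using sum_squares_bound[of c \<sigma>] \<sigma>(2) by (intro real_le_rsqrt) (simp add: power2_sum)
  then have "C * (c + \<sigma>) \<le> C * sqrt 2" using C by (intro mult_left_mono) auto
  then have CM: "C * (c + \<sigma>) \<le> M" by (simp add: C_def)
  have "hyp_lipschitz M hard"
    using hard_subgradient CM by (intro hyp_lipschitz_if_subgradients) force
  moreover have "g_convex hard"
    using hard_subgradient(1) by (intro g_convex_if_subgradients) blast
  moreover have "z \<in> hyp_cball xref r" using z d \<rho> by (simp add: hyp_cball_def)
  moreover have "\<epsilon> * M * r \<le> hard (x k)" if "k < T" for k
  proof -
    have "real T \<le> 1 / 32 * (curv_zeta r / \<epsilon>^2)" using T by linarith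
    then have "real k \<le> 1 / 32 * (curv_zeta r / \<epsilon>^2)" using that by simp
    \<comment> \<open>\<open>16 / 3 * \<epsilon>^2 = 2 / 3 * c^2\<close> is the exponent that
      \<open>exp_neg_le_sqrt\<close> charges per step.\<close>
    then have "real k * (16 / 3 * \<epsilon>^2) \<le> curv_zeta r / 6" using \<epsilon> by (simp add: field_simps)
    then have "exp (- (curv_zeta r / 6)) \<le> exp (real k * (- (2 / 3) * c^2))"
      by (simp add: c2 algebra_simps)
    also have "\<dots> = (exp (- (2 / 3) * c^2))^k" by (rule exp_of_nat_mult)
    also have "\<dots> \<le> \<sigma>^k" unfolding \<sigma>_def using c_sq by (intro power_mono exp_neg_le_sqrt) auto
    finally have "exp (- (curv_zeta r / 6)) * sinh \<rho> \<le> \<sigma>^k * sinh \<rho>"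
      using \<rho> by (intro mult_right_mono) auto
    moreover have "exp (- (curv_zeta r / 6)) * sinh \<rho> = sinh (r / 2)"
      by (simp add: \<rho>_def exp_minus)
    ultimately have "sinh (r / 2) \<le> \<sigma>^k * sinh \<rho>" by simp
    then have "r / 2 \<le> arsinh (\<sigma>^k * sinh \<rho>)" by (metis sinh_arsinh_real sinh_real_le_iff)
    then have "C * c * (r / 2) \<le> C * c * arsinh (\<sigma>^k * sinh \<rho>)"
      using C c_pos by (intro mult_left_mono) auto
    also have "\<dots> \<le> hard (x k)" using low that TN by simp
    finally show ?thesis by (simp add: C_def c_def ac_simps)
  qed
  ultimately show ?thesis
    using run is_oracle_adversary hard_nonneg hard_minimizer
    by (intro exI[of _ hard] conjI bexI[of _ z] exI[of _ adversary] exI[of _ x] exI[of _ s]) auto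
qed

end
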